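(* Let $\mu\vdash n$ and $1\le k\le m\le n$. Then $$\chi_{\mu}^{(k,1^{m-k})}(q)=\frac{q^{n-m}}{(q-1)^{l(\mu)}}\sum_{i=k}^m(-1)^{m-k}\,a_{i,n-m}(\mu;q)\,q^i ,$$ and, when $(k,m-k)$ is a partition (i.e. $m-k\le k$), $$\chi_{\mu}^{(k,m-k)}(q)=\frac{q^n}{(q-1)^{l(\mu)}}\left(b_{k,m-k}(\mu;q)-b_{k+1,m-k-1}(\mu;q)\right).$$
   Context: Compositions: a composition $\tau\models k$ is a finite sequence of nonnegative integers with sum $k$; $l(\tau)$ is the number of nonzero entries of $\tau$ (also for partitions). For a partition or composition $\mu$, $\tau\subset\mu$ means $\tau_i\le\mu_i$ for all $i$, and $C(\mu;k)=\{\tau\subset\mu:\tau\models k\}$ (sequences with the same number of entries as $\mu$; empty if $k<0$). Subtraction is entrywise. For $\mu\vdash n$ define, for $i,j\ge 0$ with $i+j\le n$, $$a_{ij}(\mu;t)=\sum_{\tau\in C(\mu;i)}\sum_{\theta\in C(\mu-\tau;j)}(1-t^{-1})^{l(\tau)+l(\theta)}(1-t)^{l(\mu-\tau-\theta)},$$ $$b_{ij}(\mu;t)=\sum_{\tau\in C(\mu;i)}\sum_{\theta\in C(\mu-\tau;j)}(1-t^{-1})^{l(\tau)+l(\theta)+l(\mu-\tau-\theta)},$$ and $a_{ij}(\mu;t)=b_{ij}(\mu;t)=0$ if $i+j>n$; also $b_{ij}(\mu;t)=0$ if $j<0$. The $q$-rook monoid algebra: let $q$ be an indeterminate. For $n\ge2$,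 $R_n(q)$ is the unital associative $\mathbb{C}(q)$-algebra with generators $T_1,\ldots,T_{n-1},P_1,\ldots,P_n$ and relations: $(T_i-q)(T_i+1)=0$; $T_iT_j=T_jT_i$ for $|i-j|>1$; $T_iT_{i+1}T_i=T_{i+1}T_iT_{i+1}$; $T_iP_j=P_jT_i=qP_j$ for $1\le i<j\le n$; $T_iP_j=P_jT_i$ for $1\le j<i\le n-1$; $P_i^2=P_i$; $P_{i+1}=qP_iT_i^{-1}P_i$ for $1\le i\le n-1$. Also $R_0(q)=\mathbb{C}(q)$ and $R_1(q)$ is spanned by $1,P_1$ with $P_1^2=P_1$. This algebra is semisimple, with irreducible characters $\chi^\lambda_{R_n(q)}$ indexed by partitions $\lambda\vdash k$, $0\le k\le n$. For a partition $\mu=(\mu_1,\ldots,\mu_l)\vdash n$ with positive parts, the standard element $T_\mu$ is the product, in increasing order of $j$, of all $T_j$ with $1\le j\le n-1$ and $j\notin\{\mu_1,\mu_1+\mu_2,\ldots,\mu_1+\cdots+\mu_{l-1}\}$. Write $\chi^\lambda_\mu(q)=\chi^\lambda_{R_n(q)}(T_\mu)$, with $n=|\mu|$. The values $\chi^\lambda_\mu(q)$ are determined by the known Frobenius formula (Dieng–Halverson–Poladian), valid for every $\mu\vdash n$, which may be taken as their definition: $$\frac{q^{n}}{(q-1)^{l(\mu)}}\,\hat q_\mu(q^{-1})=\sum_{k=0}^n\sum_{\lambda\vdash k}\chi^\lambda_\mu(q)\,s_\lambda .$$ Here $s_\lambda$ are the Schur functions, $p_n$ the power sums, $\hat p_n=1+p_n$,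 $\hat q_n(t)$ is defined by $\sum_{n\ge0}\hat q_n(t)z^n=\exp\left(\sum_{n\ge1}\frac{1-t^n}{n}\hat p_nz^n\right)$, and $\hat q_\mu(t)=\hat q_{\mu_1}(t)\hat q_{\mu_2}(t)\cdots$. *)

theory Defs
  imports
    "HOL-Computational_Algebra.Computational_Algebra"
    "HOL-Library.Poly_Mapping"
    "HOL-Library.FuncSet"
begin

type_synonym ratfun = "complex poly fract"

definition q_indet :: ratfun where
  "q_indet = Fract [:0, 1:] 1"

(* A polynomial over C(q) in variables x_0, x_1, ..., as a finitely supported map from
   exponent vectors to coefficients; multiplication on this type is convolution. *)
type_synonym mpol = "(nat \<Rightarrow>\<^sub>0 nat) \<Rightarrow>\<^sub>0 ratfun"

definition const :: "ratfun \<Rightarrow> mpol" where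
  "const c = Poly_Mapping.single 0 c"

definition var :: "nat \<Rightarrow> mpol" where
  "var i = Poly_Mapping.single (Poly_Mapping.single i 1) 1"

definition partitions :: "nat \<Rightarrow> nat list set" where
  "partitions n = {mu. sorted_wrt (\<ge>) mu \<and> 0 \<notin> set mu \<and> sum_list mu = n}"

definition nonzero_length :: "nat list \<Rightarrow> nat" where
  "nonzero_length tau = length (filter (\<lambda>x. x \<noteq> 0) tau)"

(* C(mu;k). The index k is an integer, so that the set is empty for k < 0. *)
definition subcompositions :: "nat list \<Rightarrow> int \<Rightarrow> nat list set" where
  "subcompositions mu k =
     {tau. length tau = length mu \<and> (\<forall>i<length mu. tau ! i \<le> mu ! i) \<and> int (sum_list tau) = k}"

(* Entrywise subtraction; below, the subtrahend is always contained in the minuend, so that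
   truncation does not occur. *)
definition list_diff :: "nat list \<Rightarrow> nat list \<Rightarrow> nat list" where
  "list_diff mu tau = map2 (-) mu tau"

definition a_coeff :: "nat list \<Rightarrow> int \<Rightarrow> int \<Rightarrow> ratfun \<Rightarrow> ratfun" where
  "a_coeff mu i j t =
     (if 0 \<le> i \<and> 0 \<le> j \<and> i + j \<le> int (sum_list mu) then
        (\<Sum>tau\<in>subcompositions mu i. \<Sum>theta\<in>subcompositions (list_diff mu tau) j.
           (1 - inverse t) ^ (nonzero_length tau + nonzero_length theta) *
           (1 - t) ^ nonzero_length (list_diff (list_diff mu tau) theta))
      else 0)"

definition b_coeff :: "nat list \<Rightarrow> int \<Rightarrow> int \<Rightarrow> ratfun \<Rightarrow> ratfun" where
  "b_coeff mu i j t =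
     (if 0 \<le> i \<and> 0 \<le> j \<and> i + j \<le> int (sum_list mu) then
        (\<Sum>tau\<in>subcompositions mu i. \<Sum>theta\<in>subcompositions (list_diff mu tau) j.
           (1 - inverse t) ^ (nonzero_length tau + nonzero_length theta +
             nonzero_length (list_diff (list_diff mu tau) theta)))
      else 0)"

(* Symmetric functions are handled through their images in N variables, for every N: an
   identity of symmetric functions (of bounded degree) holds iff it holds in x_0, ..., x_{N-1}
   for all N. *)

definition diagram :: "nat list \<Rightarrow> (nat \<times> nat) set" where
  "diagram lam = {(i, j). i < length lam \<and> j < lam ! i}"

definition semistandard_tableaux :: "nat \<Rightarrow> nat list \<Rightarrow> (nat \<times> nat \<Rightarrow> nat) set" where
  "semistandard_tableaux N lam =
     {T \<in> diagram lam \<rightarrow>\<^sub>E {..<N}.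
        (\<forall>i j. (i, j) \<in> diagram lam \<and> (i, Suc j) \<in> diagram lam \<longrightarrow> T (i, j) \<le> T (i, Suc j)) \<and>
        (\<forall>i j. (i, j) \<in> diagram lam \<and> (Suc i, j) \<in> diagram lam \<longrightarrow> T (i, j) < T (Suc i, j))}"

definition schur :: "nat \<Rightarrow> nat list \<Rightarrow> mpol" where
  "schur N lam = (\<Sum>T\<in>semistandard_tableaux N lam. \<Prod>c\<in>diagram lam. var (T c))"

definition power_sum :: "nat \<Rightarrow> nat \<Rightarrow> mpol" where
  "power_sum N n = (\<Sum>i<N. var i ^ n)"

definition p_hat :: "nat \<Rightarrow> nat \<Rightarrow> mpol" where
  "p_hat N n = 1 + power_sum N n"

(* The exponential series over the coefficient ring mpol, which is not a field, so that
   fps_exp does not apply. *)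
definition exp_series :: "mpol fps" where
  "exp_series = Abs_fps (\<lambda>n. const (inverse (of_nat (fact n))))"

definition q_hat_series :: "nat \<Rightarrow> ratfun \<Rightarrow> mpol fps" where
  "q_hat_series N t =
     fps_compose exp_series
       (Abs_fps (\<lambda>n. if n = 0 then 0 else const ((1 - t ^ n) / of_nat n) * p_hat N n))"

definition q_hat :: "nat \<Rightarrow> nat \<Rightarrow> ratfun \<Rightarrow> mpol" where
  "q_hat N n t = fps_nth (q_hat_series N t) n"

definition q_hat_part :: "nat \<Rightarrow> nat list \<Rightarrow> ratfun \<Rightarrow> mpol" where
  "q_hat_part N mu t = prod_list (map (\<lambda>n. q_hat N n t) mu)"

(* chi lam mu is the value at the standard element T_mu of the irreducible character of the
   q-rook monoid algebra R_n(q), n = |mu|, indexed by lam. These values are defined by the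
   Frobenius formula of Dieng, Halverson and Poladian; it determines them uniquely for every
   mu of size n and lam of size at most n, because the Schur functions are linearly independent. *)
definition q_rook_characters :: "(nat list \<Rightarrow> nat list \<Rightarrow> ratfun) \<Rightarrow> bool" where
  "q_rook_characters chi \<longleftrightarrow>
     (\<forall>n. \<forall>mu\<in>partitions n. \<forall>N.
        const (q_indet ^ n / (q_indet - 1) ^ length mu) * q_hat_part N mu (inverse q_indet) =
        (\<Sum>k=0..n. \<Sum>lam\<in>partitions k. const (chi lam mu) * schur N lam))"

definition hook :: "nat \<Rightarrow> nat \<Rightarrow> nat list" where
  "hook k r = k # replicate r 1"

(* The partition (k, l), with a zero second part dropped. *)
definition two_row :: "nat \<Rightarrow> nat \<Rightarrow> nat list" where
  "two_row k l = (if l = 0 then [k] else [k, l])"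

end

theory Submission
  imports Defs
begin

text \<open>The Frobenius formula is an identity of symmetric functions, so it survives every substitution for
the variables. Its left side is convenient for this, because the exponential series collapses
(\<open>q_hat_series_value\<close>) to \<open>(1 - tz) / (1 - z)\<close> times the product over \<open>i\<close> of
\<open>(1 - t x\<^sub>i z) / (1 - x\<^sub>i z)\<close>.
Each of the two families of shapes is isolated by a substitution with values in the polynomials in
\<open>X\<close> and \<open>Y\<close>; on the right side only Schur functions of few shapes remain.

For two rows, take the two variables \<open>X\<close> and \<open>Y\<close>. Then \<open>s\<^sub>\<lambda>\<close> vanishes if \<open>\<lambda>\<close> has more than two
rows, and \<open>s\<close> of shape \<open>(c, d)\<close> is the sum of the \<open>X\<^sup>a Y\<^sup>b\<close> with \<open>a + b = c + d\<close> and \<open>d \<le> a \<le> c\<close>.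
Hence the coefficient of \<open>X\<^sup>k Y\<^sup>r\<close> minus that of \<open>X\<^bsup>k+1\<^esup> Y\<^bsup>r-1\<^esup>\<close> picks out the shape \<open>(k, r)\<close> (\<open>schur_value_coeff_diff\<close>).

For hooks, send the power sums \<open>p\<^sub>n\<close> to \<open>X\<^sup>n - Y\<^sup>n\<close>. Then \<open>s\<^sub>\<lambda>\<close> vanishes unless \<open>\<lambda>\<close> is a hook
or empty, and the hook with arm row \<open>k\<close> and \<open>r\<close> further boxes goes to
\<open>X\<^bsup>k-1\<^esup> (X - Y) (-Y)\<^sup>r\<close>. The factor \<open>X - Y\<close> makes sums of coefficients along an antidiagonal
telescope (\<open>hook_value_coeff_sum\<close>), which explains the sum over \<open>i\<close> in the hook formula. This
substitution amounts to one variable \<open>X\<close> and minus one variable \<open>Y\<close>. It is reached from honest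
substitutions: put \<open>X\<close> for the first variable and \<open>Y\<close> for the other \<open>M - 1\<close>, for all \<open>M \<ge> 1\<close>, and
continue to \<open>M = 0\<close>. The continuation is forced because both sides are polynomial in \<open>M\<close>
(\<open>polynomial_seq_extend\<close>). On the left side the factor of \<open>Y\<close> is raised to the power \<open>M - 1\<close>,
which becomes an inverse. On the right side the branching rule \<open>schur_sum_branching\<close> is a recursion
in \<open>M\<close>, and \<open>hook_strip_sum\<close> says that the hook values above are its solution at \<open>M = 0\<close>.

In both cases each part of \<open>\<mu>\<close> contributes one coefficient of a product of three series. Expanding
these coefficients distributes every part among three compositions \<open>\<tau>\<close>, \<open>\<theta>\<close> and \<open>\<mu> - \<tau> - \<theta>\<close>, and
reading off a monomial gives the sums \<open>a\<^sub>i\<^sub>j\<close> (\<open>coeff_XY_super_product\<close>) and \<open>b\<^sub>i\<^sub>j\<close>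
(\<open>coeff_XY_two_variable_product\<close>).\<close>

section \<open>Branching of semistandard tableaux\<close>

text \<open>The shapes \<open>\<mu>\<close> such that \<open>\<lambda>/\<mu>\<close> is a horizontal strip. They keep the length of \<open>\<lambda>\<close>, so rows that
become empty stay as trailing zeros; a diagram does not see them. The recursion displays the rows of
\<open>\<mu>\<close> as independent choices, so that sums over strips of products over rows factor.\<close>

fun strips :: "nat list \<Rightarrow> nat list set" where
  "strips [] = {[]}"
| "strips [a] = (\<lambda>c. [c]) ` {0..a}"
| "strips (a # b # l) = (\<lambda>(c, m). c # m) ` ({b..a} \<times> strips (b # l))"

lemma finite_strips [simp]: "finite (strips lam)"
  by (induction lam rule: strips.induct) auto

lemma strips_iff:
  "mu \<in> strips lam \<longleftrightarrow>
     length mu = length lam \<and>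
     (\<forall>i<length lam. mu ! i \<le> lam ! i \<and> (Suc i < length lam \<longrightarrow> lam ! Suc i \<le> mu ! i))"
proof (induction lam arbitrary: mu rule: strips.induct)
  case (2 a)
  then show ?case by (cases mu) auto
next
  case (3 a b l)
  show ?case
  proof (cases mu)
    case (Cons c m)
    have "mu \<in> strips (a # b # l) \<longleftrightarrow> b \<le> c \<and> c \<le> a \<and> m \<in> strips (b # l)"
      using Cons by auto
    then show ?thesis
      unfolding 3 using Cons by (auto simp: less_Suc_eq_0_disj nth_Cons split: nat.splits)
  qed auto
qed auto

lemma strips_sum_list_le: "mu \<in> strips lam \<Longrightarrow> sum_list mu \<le> sum_list lam"
  by (induction lam arbitrary: mu rule: strips.induct) (auto intro!: add_mono[of _ _ _ "_ + _"])

lemma strips_sum_list_eqD: "mu \<in> strips lam \<Longrightarrow> sum_list mu = sum_list lam \<Longrightarrow> mu = lam"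
proof (induction lam arbitrary: mu rule: strips.induct)
  case (3 a b l)
  then obtain c m where m: "mu = c # m" "c \<le> a" "m \<in> strips (b # l)"
    by auto
  then show ?case using 3 strips_sum_list_le[OF m(3)] by fastforce
qed auto

lemma strips_self: "sorted_wrt (\<ge>) lam \<Longrightarrow> lam \<in> strips lam"
  by (induction lam rule: strips.induct) auto

lemma strips_sorted:
  assumes "sorted_wrt (\<ge>) lam" "mu \<in> strips lam"
  shows "sorted_wrt (\<ge>) mu"
proof -
  have "mu ! Suc i \<le> mu ! i" if "Suc i < length mu" for i
    using assms(2) that le_trans unfolding strips_iff by (metis Suc_lessD)
  then show ?thesis
    by (simp add: sorted_wrt_iff_nth_Suc_transp[OF transp_on_ge])
qed

lemma diagram_iff: "(i, j) \<in> diagram lam \<longleftrightarrow> i < length lam \<and> j < lam ! i"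
  by (simp add: diagram_def)

lemma diagram_Cons: "diagram (a # l) = {0} \<times> {..<a} \<union> (\<lambda>(i, j). (Suc i, j)) ` diagram l"
proof (rule set_eqI, clarify)
  fix i j
  show "(i, j) \<in> diagram (a # l) \<longleftrightarrow>
    (i, j) \<in> {0} \<times> {..<a} \<union> (\<lambda>(i, j). (Suc i, j)) ` diagram l"
    by (cases i) (auto simp: diagram_def)
qed

lemma finite_diagram [simp]: "finite (diagram lam)"
  by (induction lam) (auto simp: diagram_Cons, simp add: diagram_def)

lemma card_diagram: "card (diagram lam) = sum_list lam"
proof (induction lam)
  case (Cons a l)
  have "card ((\<lambda>(i, j). (Suc i, j)) ` diagram l) = card (diagram l)"
    by (rule card_image) (auto simp: inj_on_def)
  then show ?case
    using Cons by (subst diagram_Cons, subst card_Un_disjoint) auto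
qed (simp add: diagram_def)

lemma diagram_mono: "mu \<in> strips lam \<Longrightarrow> diagram mu \<subseteq> diagram lam"
  by (fastforce simp: strips_iff diagram_def)

text \<open>Schur polynomials are evaluated before the branching rule is applied, so that the rule is available
for all substituted values, repeated ones included.\<close>

definition schur_sum :: "(nat \<Rightarrow> 'a::comm_ring_1) \<Rightarrow> nat \<Rightarrow> nat list \<Rightarrow> 'a" where
  "schur_sum z N lam = (\<Sum>T\<in>semistandard_tableaux N lam. \<Prod>c\<in>diagram lam. z (T c))"

lemma finite_semistandard_tableaux [simp]: "finite (semistandard_tableaux N lam)"
  by (rule finite_subset[of _ "diagram lam \<rightarrow>\<^sub>E {..<N}"])
     (auto simp: semistandard_tableaux_def intro: finite_PiE)

lemma semistandard_tableauxI:
  assumes "T \<in> diagram lam \<rightarrow>\<^sub>E {..<N}"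
    and "\<And>i j. (i, j) \<in> diagram lam \<Longrightarrow> (i, Suc j) \<in> diagram lam \<Longrightarrow> T (i, j) \<le> T (i, Suc j)"
    and "\<And>i j. (i, j) \<in> diagram lam \<Longrightarrow> (Suc i, j) \<in> diagram lam \<Longrightarrow> T (i, j) < T (Suc i, j)"
  shows "T \<in> semistandard_tableaux N lam"
  using assms by (auto simp: semistandard_tableaux_def)

lemma semistandard_tableauxD:
  assumes "T \<in> semistandard_tableaux N lam"
  shows "c \<in> diagram lam \<Longrightarrow> T c < N"
    and "c \<notin> diagram lam \<Longrightarrow> T c = undefined"
    and "(i, j) \<in> diagram lam \<Longrightarrow> (i, Suc j) \<in> diagram lam \<Longrightarrow> T (i, j) \<le> T (i, Suc j)"
    and "(i, j) \<in> diagram lam \<Longrightarrow> (Suc i, j) \<in> diagram lam \<Longrightarrow> T (i, j) < T (Suc i, j)"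
  using assms by (auto simp: semistandard_tableaux_def dest: PiE_mem PiE_arb)

lemma semistandard_tableaux_row_mono:
  assumes T: "T \<in> semistandard_tableaux N lam" and "j \<le> j'" "(i, j') \<in> diagram lam"
  shows "T (i, j) \<le> T (i, j')"
  using assms(2,3)
proof (induction j' rule: dec_induct)
  case (step n)
  then have "(i, n) \<in> diagram lam" by (auto simp: diagram_def)
  with step T show ?case
    using semistandard_tableauxD(3)[OF T] by fastforce
qed auto

text \<open>The entries below \<open>N\<close> of a row form an initial segment. Hence the least column where the row ends or
has an entry that is not below \<open>N\<close> is the length of that segment.\<close>

definition inner_shape :: "nat \<Rightarrow> nat list \<Rightarrow> (nat \<times> nat \<Rightarrow> nat) \<Rightarrow> nat list" where
  "inner_shape N lam T =
     map (\<lambda>i. LEAST j. \<not> (j < lam ! i \<and> T (i, j) < N)) [0..<length lam]"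

definition extend_tableau ::
    "nat \<Rightarrow> nat list \<Rightarrow> nat list \<Rightarrow> (nat \<times> nat \<Rightarrow> nat) \<Rightarrow> nat \<times> nat \<Rightarrow> nat" where
  "extend_tableau N lam mu T =
     (\<lambda>c. if c \<in> diagram mu then T c else if c \<in> diagram lam then N else undefined)"

lemma inner_shape_nth:
  assumes T: "T \<in> semistandard_tableaux (Suc N) lam" and i: "i < length lam"
  shows "j < inner_shape N lam T ! i \<longleftrightarrow> j < lam ! i \<and> T (i, j) < N"
proof -
  define P where "P j \<longleftrightarrow> j < lam ! i \<and> T (i, j) < N" for j
  have eq: "inner_shape N lam T ! i = (LEAST j. \<not> P j)"
    using i by (simp add: inner_shape_def P_def)
  have ex: "\<not> P (lam ! i)" by (simp add: P_def)
  have down: "P a" if "P b" "a \<le> b" for a b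
  proof -
    have "(i, b) \<in> diagram lam" using that i by (simp add: P_def diagram_def)
    then have "T (i, a) \<le> T (i, b)"
      using semistandard_tableaux_row_mono[OF T] that by blast
    then show ?thesis using that by (auto simp: P_def)
  qed
  have "\<not> P (LEAST j. \<not> P j)" using ex by (rule LeastI)
  then have "j < (LEAST j. \<not> P j) \<longleftrightarrow> P j"
    using down not_less_Least[of j "\<lambda>j. \<not> P j"] by (meson not_le)
  then show ?thesis by (simp add: eq P_def)
qed

lemma diagram_inner_shape:
  assumes T: "T \<in> semistandard_tableaux (Suc N) lam"
  shows "diagram (inner_shape N lam T) = {c \<in> diagram lam. T c < N}"
proof -
  have "length (inner_shape N lam T) = length lam" by (simp add: inner_shape_def)
  then show ?thesis
    using inner_shape_nth[OF T] by (auto simp: diagram_def)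
qed

lemma inner_shape_strips:
  assumes lam: "sorted_wrt (\<ge>) lam" and T: "T \<in> semistandard_tableaux (Suc N) lam"
  shows "inner_shape N lam T \<in> strips lam"
  unfolding strips_iff
proof (intro conjI allI impI)
  show "length (inner_shape N lam T) = length lam" by (simp add: inner_shape_def)
next
  fix i assume i: "i < length lam"
  show "inner_shape N lam T ! i \<le> lam ! i"
    using inner_shape_nth[OF T i] by (meson less_le_not_le not_le)
  assume si: "Suc i < length lam"
  show "lam ! Suc i \<le> inner_shape N lam T ! i"
  proof (rule ccontr)
    assume "\<not> ?thesis"
    then have j: "inner_shape N lam T ! i < lam ! Suc i" (is "?j < _") by simp
    have "lam ! Suc i \<le> lam ! i" using lam si by (simp add: sorted_wrt_iff_nth_less)
    with j have d: "(i, ?j) \<in> diagram lam" "(Suc i, ?j) \<in> diagram lam"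
      using i si by (auto simp: diagram_def)
    then have "T (i, ?j) < T (Suc i, ?j)" "T (Suc i, ?j) < Suc N"
      using semistandard_tableauxD(1,4)[OF T] by auto
    then have "T (i, ?j) < N" by simp
    then have "?j < ?j" unfolding inner_shape_nth[OF T i] using d by (simp add: diagram_def)
    then show False by simp
  qed
qed

lemma restrict_semistandard_tableaux:
  assumes lam: "sorted_wrt (\<ge>) lam" and T: "T \<in> semistandard_tableaux (Suc N) lam"
  shows "restrict T (diagram (inner_shape N lam T)) \<in> semistandard_tableaux N (inner_shape N lam T)"
proof -
  have sub: "diagram (inner_shape N lam T) \<subseteq> diagram lam"
    using diagram_mono inner_shape_strips[OF lam T] by blast
  show ?thesis
  proof (rule semistandard_tableauxI)
    show "restrict T (diagram (inner_shape N lam T)) \<in>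
        diagram (inner_shape N lam T) \<rightarrow>\<^sub>E {..<N}"
      by (auto simp: diagram_inner_shape[OF T])
  next
    fix i j
    assume 1: "(i, j) \<in> diagram (inner_shape N lam T)"
    show "restrict T (diagram (inner_shape N lam T)) (i, j) \<le>
        restrict T (diagram (inner_shape N lam T)) (i, Suc j)"
      if 2: "(i, Suc j) \<in> diagram (inner_shape N lam T)"
      using semistandard_tableauxD(3)[OF T] sub 1 2 by (simp add: subset_iff)
    show "restrict T (diagram (inner_shape N lam T)) (i, j) <
        restrict T (diagram (inner_shape N lam T)) (Suc i, j)"
      if 2: "(Suc i, j) \<in> diagram (inner_shape N lam T)"
      using semistandard_tableauxD(4)[OF T] sub 1 2 by (simp add: subset_iff)
  qed
qed

lemma extend_semistandard_tableaux:
  assumes lam: "sorted_wrt (\<ge>) lam" and mu: "mu \<in> strips lam"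
    and T: "T \<in> semistandard_tableaux N mu"
  shows "extend_tableau N lam mu T \<in> semistandard_tableaux (Suc N) lam"
proof (rule semistandard_tableauxI)
  have sub: "diagram mu \<subseteq> diagram lam" using mu by (rule diagram_mono)
  have less: "T c < N" if "c \<in> diagram mu" for c
    using semistandard_tableauxD(1)[OF T that] .
  show "extend_tableau N lam mu T \<in> diagram lam \<rightarrow>\<^sub>E {..<Suc N}"
    using sub less by (fastforce simp: extend_tableau_def)
  fix i j assume 1: "(i, j) \<in> diagram lam"
  {
    assume 2: "(i, Suc j) \<in> diagram lam"
    have "(i, Suc j) \<in> diagram mu \<Longrightarrow> (i, j) \<in> diagram mu"
      by (simp add: diagram_def)
    then show "extend_tableau N lam mu T (i, j) \<le> extend_tableau N lam mu T (i, Suc j)"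
      using semistandard_tableauxD(3)[OF T] 1 2 less by (auto simp: extend_tableau_def less_imp_le)
  }
  assume 2: "(Suc i, j) \<in> diagram lam"
  then have "(i, j) \<in> diagram mu"
    using mu by (auto simp: strips_iff diagram_def) (meson Suc_lessD less_le_trans)
  then show "extend_tableau N lam mu T (i, j) < extend_tableau N lam mu T (Suc i, j)"
    using semistandard_tableauxD(4)[OF T] 1 2 less by (auto simp: extend_tableau_def)
qed

text \<open>Removing the boxes with the largest entry \<open>N\<close> from a tableau leaves a tableau with smaller entries.
Since columns increase strictly, at most one \<open>N\<close> stands in each column, so a horizontal strip has been
removed; conversely any horizontal strip may be filled with \<open>N\<close>.\<close>

theorem schur_sum_branching:
  assumes lam: "sorted_wrt (\<ge>) lam"
  shows "schur_sum z (Suc N) lam =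
    (\<Sum>mu\<in>strips lam. z N ^ (sum_list lam - sum_list mu) * schur_sum z N mu)"
proof -
  have "schur_sum z (Suc N) lam =
      (\<Sum>(mu, T)\<in>(SIGMA mu:strips lam. semistandard_tableaux N mu).
        z N ^ (sum_list lam - sum_list mu) * (\<Prod>c\<in>diagram mu. z (T c)))"
    unfolding schur_sum_def
  proof (rule sum.reindex_bij_witness[where
      i = "\<lambda>(mu, T). extend_tableau N lam mu T" and
      j = "\<lambda>T. (inner_shape N lam T, restrict T (diagram (inner_shape N lam T)))"])
    fix T assume T: "T \<in> semistandard_tableaux (Suc N) lam"
    let ?mu = "inner_shape N lam T"
    note d = diagram_inner_shape[OF T]
    have rng: "T c < Suc N" if "c \<in> diagram lam" for c
      using semistandard_tableauxD(1)[OF T that] .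
    have out: "T c = undefined" if "c \<notin> diagram lam" for c
      using semistandard_tableauxD(2)[OF T that] .
    show "(case (?mu, restrict T (diagram ?mu)) of (mu, T) \<Rightarrow> extend_tableau N lam mu T) = T"
      using rng out by (fastforce simp: d extend_tableau_def fun_eq_iff)
    show "(?mu, restrict T (diagram ?mu)) \<in> (SIGMA mu:strips lam. semistandard_tableaux N mu)"
      using inner_shape_strips[OF lam T] restrict_semistandard_tableaux[OF lam T] by auto
    have sub: "diagram ?mu \<subseteq> diagram lam" using d by auto
    have "(\<Prod>c\<in>diagram lam. z (T c)) =
        (\<Prod>c\<in>diagram lam - diagram ?mu. z (T c)) * (\<Prod>c\<in>diagram ?mu. z (T c))"
      by (rule prod.subset_diff[OF sub]) simp
    also have "(\<Prod>c\<in>diagram lam - diagram ?mu. z (T c)) = (\<Prod>c\<in>diagram lam - diagram ?mu. z N)"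
    proof (rule prod.cong)
      fix c assume "c \<in> diagram lam - diagram ?mu"
      then have "T c = N" using rng d by fastforce
      then show "z (T c) = z N" by simp
    qed simp
    also have "\<dots> = z N ^ (sum_list lam - sum_list ?mu)"
      by (simp add: card_Diff_subset sub finite_subset[OF sub] card_diagram)
    finally show "(case (?mu, restrict T (diagram ?mu)) of (mu, T) \<Rightarrow>
        z N ^ (sum_list lam - sum_list mu) * (\<Prod>c\<in>diagram mu. z (T c))) =
        (\<Prod>c\<in>diagram lam. z (T c))" by simp
  next
    fix p assume "p \<in> (SIGMA mu:strips lam. semistandard_tableaux N mu)"
    then obtain mu T where p: "p = (mu, T)" and mu: "mu \<in> strips lam"
      and T: "T \<in> semistandard_tableaux N mu" by auto
    let ?E = "extend_tableau N lam mu T"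
    have E: "?E \<in> semistandard_tableaux (Suc N) lam"
      using extend_semistandard_tableaux[OF lam mu T] .
    have less: "T c < N" if "c \<in> diagram mu" for c
      using semistandard_tableauxD(1)[OF T that] .
    have out: "T c = undefined" if "c \<notin> diagram mu" for c
      using semistandard_tableauxD(2)[OF T that] .
    have "diagram (inner_shape N lam ?E) = diagram mu"
      using less diagram_mono[OF mu]
      unfolding diagram_inner_shape[OF E] by (auto simp: extend_tableau_def split: if_splits)
    moreover have "length mu = length lam" "length (inner_shape N lam ?E) = length lam"
      using mu by (auto simp: strips_iff inner_shape_def)
    ultimately have inner: "inner_shape N lam ?E = mu"
      by (auto simp: set_eq_iff diagram_iff list_eq_iff_nth_eq)
         (metis linorder_neqE_nat less_irrefl)
    show "(inner_shape N lam (case p of (mu, T) \<Rightarrow> extend_tableau N lam mu T),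
        restrict (case p of (mu, T) \<Rightarrow> extend_tableau N lam mu T)
          (diagram (inner_shape N lam (case p of (mu, T) \<Rightarrow> extend_tableau N lam mu T)))) = p"
      unfolding p prod.case inner using out by (auto simp: fun_eq_iff extend_tableau_def)
    show "(case p of (mu, T) \<Rightarrow> extend_tableau N lam mu T) \<in> semistandard_tableaux (Suc N) lam"
      using E p by simp
  qed
  also have "\<dots> = (\<Sum>mu\<in>strips lam. z N ^ (sum_list lam - sum_list mu) * schur_sum z N mu)"
    by (subst sum.Sigma[symmetric]) (auto simp: schur_sum_def sum_distrib_left)
  finally show ?thesis .
qed

lemma schur_sum_0: "schur_sum z 0 lam = (if sum_list lam = 0 then 1 else 0)"
proof (cases "diagram lam = {}")
  case True
  then have "semistandard_tableaux 0 lam = {\<lambda>_. undefined}"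
    by (auto simp: semistandard_tableaux_def)
  then show ?thesis using True card_diagram[of lam] by (simp add: schur_sum_def)
next
  case False
  then have "semistandard_tableaux 0 lam = {}"
    by (auto simp: semistandard_tableaux_def PiE_eq_empty_iff)
  moreover have "sum_list lam \<noteq> 0"
    using False by (simp add: card_diagram[symmetric] del: sum_list_eq_0_iff)
  ultimately show ?thesis by (simp add: schur_sum_def)
qed

section \<open>Evaluation in two indeterminates\<close>

text \<open>Characteristic zero is needed for the denominators in the logarithm and the exponential, and for the
uniqueness of solutions of differential equations.\<close>

instance fract :: ("{idom, ring_char_0}") ring_char_0
  by standard (auto simp: inj_on_def of_nat_fract eq_fract)

type_synonym bipoly = "ratfun poly poly"

definition scalar :: "ratfun \<Rightarrow> bipoly" where
  "scalar c = [:[:c:]:]"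

lemma scalar_simps [simp]:
  "scalar 0 = 0" "scalar 1 = 1"
  "scalar (a + b) = scalar a + scalar b" "scalar (a - b) = scalar a - scalar b"
  "scalar (- a) = - scalar a" "scalar (a * b) = scalar a * scalar b"
  by (simp_all add: scalar_def one_pCons)

lemma scalar_power [simp]: "scalar (a ^ n) = scalar a ^ n"
  by (induction n) simp_all

lemma scalar_of_nat [simp]: "scalar (of_nat n) = of_nat n"
  by (induction n) simp_all

definition monomial_value :: "(nat \<Rightarrow> bipoly) \<Rightarrow> (nat \<Rightarrow>\<^sub>0 nat) \<Rightarrow> bipoly" where
  "monomial_value z m = (\<Prod>i\<in>Poly_Mapping.keys m. z i ^ Poly_Mapping.lookup m i)"

text \<open>Substitution of \<open>z i\<close> for the variable \<open>i\<close>. The following lemmas show that it is a ring homomorphism.\<close>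

definition mpol_value :: "(nat \<Rightarrow> bipoly) \<Rightarrow> mpol \<Rightarrow> bipoly" where
  "mpol_value z p = (\<Sum>m\<in>Poly_Mapping.keys p. scalar (Poly_Mapping.lookup p m) * monomial_value z m)"

lemma monomial_value_superset:
  assumes "finite A" "Poly_Mapping.keys m \<subseteq> A"
  shows "monomial_value z m = (\<Prod>i\<in>A. z i ^ Poly_Mapping.lookup m i)"
  unfolding monomial_value_def
  by (rule prod.mono_neutral_left) (use assms in \<open>auto simp: in_keys_iff\<close>)

lemma monomial_value_add: "monomial_value z (a + b) = monomial_value z a * monomial_value z b"
proof -
  let ?A = "Poly_Mapping.keys a \<union> Poly_Mapping.keys b"
  have "monomial_value z c = (\<Prod>i\<in>?A. z i ^ Poly_Mapping.lookup c i)" if "Poly_Mapping.keys c \<subseteq> ?A" for c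
    by (rule monomial_value_superset) (use that in auto)
  then show ?thesis
    using keys_add[of a b] by (simp add: lookup_add power_add prod.distrib)
qed

lemma mpol_value_superset:
  assumes "finite A" "Poly_Mapping.keys p \<subseteq> A"
  shows "mpol_value z p = (\<Sum>m\<in>A. scalar (Poly_Mapping.lookup p m) * monomial_value z m)"
  unfolding mpol_value_def
  by (rule sum.mono_neutral_left) (use assms in \<open>auto simp: in_keys_iff\<close>)

lemma mpol_value_add: "mpol_value z (p + q) = mpol_value z p + mpol_value z q"
proof -
  let ?A = "Poly_Mapping.keys p \<union> Poly_Mapping.keys q"
  have "mpol_value z r = (\<Sum>m\<in>?A. scalar (Poly_Mapping.lookup r m) * monomial_value z m)"
    if "Poly_Mapping.keys r \<subseteq> ?A" for r
    by (rule mpol_value_superset) (use that in auto)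
  then show ?thesis
    using keys_add[of p q] by (simp add: lookup_add sum.distrib distrib_right)
qed

lemma mpol_value_0 [simp]: "mpol_value z 0 = 0"
  by (simp add: mpol_value_def)

lemma mpol_value_single: "mpol_value z (Poly_Mapping.single m c) = scalar c * monomial_value z m"
  by (cases "c = 0") (simp_all add: mpol_value_def)

lemma mpol_value_const [simp]: "mpol_value z (const c) = scalar c"
  by (simp add: const_def mpol_value_single monomial_value_def)

lemma mpol_value_var [simp]: "mpol_value z (var i) = z i"
  by (simp add: var_def mpol_value_single monomial_value_def)

lemma mpol_value_1 [simp]: "mpol_value z 1 = 1"
  using mpol_value_const[of z 1] by (simp add: const_def)

lemma mpol_value_sum: "mpol_value z (\<Sum>a\<in>A. f a) = (\<Sum>a\<in>A. mpol_value z (f a))"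
  by (induction A rule: infinite_finite_induct) (simp_all add: mpol_value_add)

lemma poly_mapping_sum_single:
  fixes p :: "'a \<Rightarrow>\<^sub>0 'b::comm_monoid_add"
  shows "p = (\<Sum>m\<in>Poly_Mapping.keys p. Poly_Mapping.single m (Poly_Mapping.lookup p m))"
  by (rule poly_mapping_eqI)
     (simp add: lookup_sum lookup_single when_def in_keys_iff)

lemma mpol_value_mult: "mpol_value z (p * q) = mpol_value z p * mpol_value z q"
proof -
  have "p * q = (\<Sum>a\<in>Poly_Mapping.keys p. \<Sum>b\<in>Poly_Mapping.keys q.
      Poly_Mapping.single (a + b) (Poly_Mapping.lookup p a * Poly_Mapping.lookup q b))"
    by (subst poly_mapping_sum_single[of p], subst poly_mapping_sum_single[of q])
       (simp add: sum_product mult_single)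
  also have "mpol_value z \<dots> =
      (\<Sum>a\<in>Poly_Mapping.keys p. \<Sum>b\<in>Poly_Mapping.keys q. scalar (Poly_Mapping.lookup p a) * scalar (Poly_Mapping.lookup q b) *
        (monomial_value z a * monomial_value z b))"
    by (simp add: mpol_value_sum mpol_value_single monomial_value_add)
  also have "\<dots> = mpol_value z p * mpol_value z q"
    by (simp add: mpol_value_def sum_product mult_ac)
  finally show ?thesis .
qed

lemma mpol_value_power [simp]: "mpol_value z (p ^ n) = mpol_value z p ^ n"
  by (induction n) (simp_all add: mpol_value_mult)

lemma mpol_value_prod: "mpol_value z (\<Prod>a\<in>A. f a) = (\<Prod>a\<in>A. mpol_value z (f a))"
  by (induction A rule: infinite_finite_induct) (simp_all add: mpol_value_mult)

lemma mpol_value_prod_list: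
  "mpol_value z (prod_list ps) = prod_list (map (mpol_value z) ps)"
  by (induction ps) (simp_all add: mpol_value_mult)

lemma mpol_value_schur: "mpol_value z (schur N lam) = schur_sum z N lam"
  by (simp add: schur_def schur_sum_def mpol_value_sum mpol_value_prod)

section \<open>The generating function\<close>

text \<open>The substitution acts on power series coefficientwise, and commutes with composition since every
coefficient of a composition is a finite polynomial expression. This moves the series of \<open>q_hat\<close> to
coefficients in an integral domain of characteristic zero, where differential equations have at most
one solution.\<close>

definition mpol_fps_value :: "(nat \<Rightarrow> bipoly) \<Rightarrow> mpol fps \<Rightarrow> bipoly fps" where
  "mpol_fps_value z f = Abs_fps (\<lambda>n. mpol_value z (f $ n))"

lemma mpol_fps_value_nth [simp]: "mpol_fps_value z f $ n = mpol_value z (f $ n)"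
  by (simp add: mpol_fps_value_def)

lemma mpol_fps_value_mult: "mpol_fps_value z (f * g) = mpol_fps_value z f * mpol_fps_value z g"
  by (rule fps_ext) (simp add: fps_mult_nth mpol_value_sum mpol_value_mult)

lemma mpol_fps_value_power: "mpol_fps_value z (f ^ n) = mpol_fps_value z f ^ n"
proof (induction n)
  case 0
  show ?case by (rule fps_ext) (simp add: fps_one_nth)
qed (simp add: mpol_fps_value_mult)

lemma mpol_fps_value_compose:
  "mpol_fps_value z (f oo g) = mpol_fps_value z f oo mpol_fps_value z g"
  by (rule fps_ext)
     (simp add: fps_compose_nth mpol_value_sum mpol_value_mult mpol_fps_value_power[symmetric])

text \<open>The expansion of \<open>(1 - taz) / (1 - az)\<close>, see \<open>linear_ratio_mult\<close>. The series of \<open>q_hat\<close> and its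
continuation to a negative number of variables are products of such series.\<close>

definition linear_ratio :: "ratfun \<Rightarrow> bipoly \<Rightarrow> bipoly fps" where
  "linear_ratio t a = Abs_fps (\<lambda>n. if n = 0 then 1 else (1 - scalar t) * a ^ n)"

lemma linear_ratio_mult:
  "(1 - fps_const a * fps_X) * linear_ratio t a = 1 - fps_const (scalar t * a) * fps_X"
proof (rule fps_ext)
  fix n
  have "((1 - fps_const a * fps_X) * linear_ratio t a) $ n =
      linear_ratio t a $ n - a * (if n = 0 then 0 else linear_ratio t a $ (n - 1))"
    by (simp add: algebra_simps)
  also have "\<dots> = (1 - fps_const (scalar t * a) * fps_X) $ n"
    by (cases n; cases "n - 1") (auto simp: linear_ratio_def algebra_simps fps_one_nth)
  finally show "((1 - fps_const a * fps_X) * linear_ratio t a) $ n =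
      (1 - fps_const (scalar t * a) * fps_X) $ n" .
qed

lemma one_minus_X_nonzero: "1 - fps_const a * fps_X \<noteq> (0 :: 'a::idom fps)"
proof
  assume "1 - fps_const a * fps_X = 0"
  then have "(1 - fps_const a * fps_X) $ 0 = (0 :: 'a fps) $ 0" by simp
  then show False by simp
qed

text \<open>The logarithm of \<open>linear_ratio\<close>; that it is one is expressed by \<open>deriv_linear_ratio\<close>.\<close>

definition log_series :: "ratfun \<Rightarrow> bipoly \<Rightarrow> bipoly fps" where
  "log_series t a = Abs_fps (\<lambda>n. scalar ((1 - t ^ n) / of_nat n) * a ^ n)"

text \<open>The derivative is \<open>a / (1 - az) - ta / (1 - taz)\<close>, here with cleared denominators. The two linear
factors are multiplied in one after the other; each step shortens the coefficients to one geometric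
sequence.\<close>

lemma deriv_log_series:
  "fps_deriv (log_series t a) * (1 - fps_const a * fps_X) * (1 - fps_const (scalar t * a) * fps_X) =
     fps_const ((1 - scalar t) * a)"
proof -
  have nth: "fps_deriv (log_series t a) $ n = (1 - scalar t ^ Suc n) * a ^ Suc n" for n
  proof -
    have "of_nat (Suc n) * scalar ((1 - t ^ Suc n) / of_nat (Suc n)) =
        scalar (of_nat (Suc n) * ((1 - t ^ Suc n) / of_nat (Suc n)))"
      by (simp only: scalar_simps scalar_of_nat)
    also have "\<dots> = 1 - scalar t ^ Suc n"
      by (simp del: of_nat_Suc power_Suc)
    finally show ?thesis
      by (simp add: log_series_def mult.assoc[symmetric] del: of_nat_Suc power_Suc)
  qed
  have 1: "fps_deriv (log_series t a) * (1 - fps_const a * fps_X) =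
      Abs_fps (\<lambda>n. (1 - scalar t) * scalar t ^ n * a ^ Suc n)" (is "?l = ?r")
  proof (rule fps_ext)
    fix n
    have "?l $ n = fps_deriv (log_series t a) $ n -
        a * (if n = 0 then 0 else fps_deriv (log_series t a) $ (n - 1))"
      by (simp add: algebra_simps del: fps_deriv_nth)
    also have "\<dots> = ?r $ n"
      unfolding nth by (cases n) (simp_all add: algebra_simps)
    finally show "?l $ n = ?r $ n" .
  qed
  show ?thesis (is "?l = ?r")
  proof (rule fps_ext)
    fix n
    let ?f = "Abs_fps (\<lambda>n. (1 - scalar t) * scalar t ^ n * a ^ Suc n)"
    have "?l $ n = ?f $ n - scalar t * a * (if n = 0 then 0 else ?f $ (n - 1))"
      unfolding 1 by (simp add: algebra_simps)
    also have "\<dots> = ?r $ n" by (cases n) (simp_all add: algebra_simps)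
    finally show "?l $ n = ?r $ n" .
  qed
qed

text \<open>With \<open>P = 1 - az\<close> and \<open>Q = 1 - taz\<close>, the relation \<open>PB = Q\<close> is differentiated and multiplied by \<open>Q\<close>;
then \<open>PQ\<close> cancels.\<close>

lemma deriv_linear_ratio:
  "fps_deriv (linear_ratio t a) = fps_deriv (log_series t a) * linear_ratio t a"
proof -
  define P where "P = 1 - fps_const a * fps_X"
  define Q where "Q = 1 - fps_const (scalar t * a) * fps_X"
  define B where "B = linear_ratio t a"
  define L where "L = fps_deriv (log_series t a)"
  have PB: "P * B = Q" unfolding P_def B_def Q_def by (rule linear_ratio_mult)
  have L: "L * P * Q = fps_const a - fps_const (scalar t * a)"
    unfolding P_def Q_def L_def deriv_log_series
    by (simp add: left_diff_distrib)
  have dP: "fps_deriv P = - fps_const a" and dQ: "fps_deriv Q = - fps_const (scalar t * a)"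
    by (simp_all add: P_def Q_def)
  have "fps_deriv (P * B) = fps_deriv Q" by (simp add: PB)
  then have "P * fps_deriv B = fps_const a * B - fps_const (scalar t * a)"
    by (simp add: dP dQ fps_const_neg[symmetric] algebra_simps del: fps_const_neg)
  then have "P * Q * fps_deriv B = Q * (fps_const a * B - fps_const (scalar t * a))"
    by (metis mult.assoc mult.commute)
  also have "\<dots> = B * (fps_const a * (P * B) - fps_const (scalar t * a) * P)"
    by (simp add: PB[symmetric] algebra_simps)
  also have "fps_const a * (P * B) - fps_const (scalar t * a) * P =
      fps_const a - fps_const (scalar t * a)"
    unfolding PB by (simp add: P_def Q_def algebra_simps)
  also have "B * \<dots> = P * Q * (L * B)" unfolding L[symmetric] by (simp only: mult_ac)
  finally have "fps_deriv B = L * B"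
    using one_minus_X_nonzero by (auto simp: P_def Q_def)
  then show ?thesis by (simp add: B_def L_def)
qed

text \<open>The equation determines each coefficient from the lower ones.\<close>

lemma fps_deriv_unique:
  fixes f g l :: "'a::{idom,ring_char_0} fps"
  assumes "fps_deriv f = l * f" "fps_deriv g = l * g" "f $ 0 = g $ 0"
  shows "f = g"
proof (rule fps_ext)
  fix n
  show "f $ n = g $ n"
  proof (induction n rule: less_induct)
    case (less n)
    show ?case
    proof (cases n)
      case (Suc m)
      have "of_nat (Suc m) * f $ Suc m = (l * f) $ m"
        using assms(1) by (metis fps_deriv_nth Suc_eq_plus1)
      also have "\<dots> = (l * g) $ m"
        unfolding fps_mult_nth using less Suc by (intro sum.cong) auto
      also have "\<dots> = of_nat (Suc m) * g $ Suc m"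
        using assms(2) by (metis fps_deriv_nth Suc_eq_plus1)
      finally show ?thesis using Suc by (simp del: of_nat_Suc)
    qed (use assms in simp)
  qed
qed

lemma deriv_exp_series_value:
  "fps_deriv (mpol_fps_value z exp_series) = mpol_fps_value z exp_series"
proof (rule fps_ext)
  fix n
  have *: "(of_nat (n + 1) :: ratfun) * inverse (of_nat (fact (n + 1))) = inverse (of_nat (fact n))"
  proof -
    have "(of_nat (fact (n + 1)) :: ratfun) = of_nat (n + 1) * of_nat (fact n)"
      by (simp only: Suc_eq_plus1[symmetric] fact_Suc of_nat_mult of_nat_id)
    then show ?thesis by (simp del: of_nat_add of_nat_Suc of_nat_fact add: mult.assoc[symmetric])
  qed
  have "of_nat (n + 1) * scalar (inverse (of_nat (fact (n + 1)))) =
      scalar (of_nat (n + 1) * inverse (of_nat (fact (n + 1))))"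
    by (simp only: scalar_simps scalar_of_nat)
  also have "\<dots> = scalar (inverse (of_nat (fact n)))"
    by (simp only: *)
  finally show "fps_deriv (mpol_fps_value z exp_series) $ n = mpol_fps_value z exp_series $ n"
    unfolding fps_deriv_nth mpol_fps_value_nth exp_series_def fps_nth_Abs_fps mpol_value_const .
qed

lemma deriv_prod_linear_ratio:
  "finite I \<Longrightarrow> fps_deriv (\<Prod>i\<in>I. linear_ratio t (w i)) =
     (\<Sum>i\<in>I. fps_deriv (log_series t (w i))) * (\<Prod>i\<in>I. linear_ratio t (w i))"
  by (induction I rule: finite_induct) (simp_all add: deriv_linear_ratio algebra_simps)

text \<open>Both sides have constant term 1 and the same logarithmic derivative. The additional factor with
\<open>a = 1\<close> comes from the summand 1 of the modified power sums, which act like power sums with one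
more variable of value 1.\<close>

lemma q_hat_series_value:
  "mpol_fps_value z (q_hat_series N t) =
     linear_ratio t 1 * (\<Prod>i<N. linear_ratio t (z i))"
proof -
  define L where "L = log_series t 1 + (\<Sum>i<N. log_series t (z i))"
  have arg: "mpol_fps_value z (Abs_fps (\<lambda>n. if n = 0 then 0 else
      const ((1 - t ^ n) / of_nat n) * p_hat N n)) = L"
  proof (rule fps_ext)
    fix n
    show "mpol_fps_value z (Abs_fps (\<lambda>n. if n = 0 then 0 else
      const ((1 - t ^ n) / of_nat n) * p_hat N n)) $ n = L $ n"
      by (cases "n = 0")
         (simp_all add: L_def log_series_def fps_sum_nth p_hat_def power_sum_def
           mpol_value_mult mpol_value_add mpol_value_sum sum_distrib_left distrib_left)
  qed
  have L0: "L $ 0 = 0" by (simp add: L_def log_series_def fps_sum_nth)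
  have "mpol_fps_value z (q_hat_series N t) = mpol_fps_value z exp_series oo L"
    unfolding q_hat_series_def mpol_fps_value_compose arg ..
  also have "\<dots> = linear_ratio t 1 * (\<Prod>i<N. linear_ratio t (z i))"
  proof (rule fps_deriv_unique)
    show "fps_deriv (mpol_fps_value z exp_series oo L) =
        fps_deriv L * (mpol_fps_value z exp_series oo L)"
      by (simp add: fps_compose_deriv[OF L0] deriv_exp_series_value mult.commute)
    show "fps_deriv (linear_ratio t 1 * (\<Prod>i<N. linear_ratio t (z i))) =
        fps_deriv L * (linear_ratio t 1 * (\<Prod>i<N. linear_ratio t (z i)))"
      by (simp add: L_def deriv_prod_linear_ratio deriv_linear_ratio fps_deriv_sum algebra_simps)
    have "(\<Prod>i<N. linear_ratio t (z i)) $ 0 = 1"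
      by (induction N) (simp_all add: linear_ratio_def)
    then show "(mpol_fps_value z exp_series oo L) $ 0 =
        (linear_ratio t 1 * (\<Prod>i<N. linear_ratio t (z i))) $ 0"
      by (simp add: exp_series_def linear_ratio_def)
  qed
  finally show ?thesis .
qed

lemma q_hat_part_value:
  "mpol_value z (q_hat_part N mu t) =
     prod_list (map (\<lambda>n. (linear_ratio t 1 * (\<Prod>i<N. linear_ratio t (z i))) $ n) mu)"
  unfolding q_hat_series_value[symmetric]
  by (simp add: q_hat_part_def q_hat_def mpol_value_prod_list comp_def)

section \<open>Polynomial sequences\<close>

definition fdiff :: "(nat \<Rightarrow> 'a::comm_ring_1) \<Rightarrow> nat \<Rightarrow> 'a" where
  "fdiff a M = a (Suc M) - a M"

text \<open>For values in a ring that contains the rationals, some iterated difference vanishes exactly for the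
sequences given by a polynomial. In this form no polynomial has to be
exhibited: a sequence is polynomial as soon as its difference is (\<open>polynomial_seq_fdiffI\<close>).\<close>

definition polynomial_seq :: "(nat \<Rightarrow> 'a::comm_ring_1) \<Rightarrow> bool" where
  "polynomial_seq a \<longleftrightarrow> (\<exists>d. (fdiff ^^ d) a = (\<lambda>_. 0))"

lemma funpow_fdiff_0 [simp]: "(fdiff ^^ d) (\<lambda>_. 0) = (\<lambda>_. 0)"
  by (induction d) (simp_all add: fdiff_def fun_eq_iff)

lemma funpow_fdiff_add:
  "(fdiff ^^ d) (\<lambda>M. a M + b M) = (\<lambda>M. (fdiff ^^ d) a M + (fdiff ^^ d) b M)"
  by (induction d) (simp_all add: fdiff_def fun_eq_iff)

lemma funpow_fdiff_shift:
  "(fdiff ^^ d) (\<lambda>M. a (Suc M)) = (\<lambda>M. (fdiff ^^ d) a (Suc M))"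
  by (induction d) (simp_all add: fdiff_def fun_eq_iff)

lemma funpow_fdiff_mono:
  assumes "(fdiff ^^ d) a = (\<lambda>_. 0)" "d \<le> e"
  shows "(fdiff ^^ e) a = (\<lambda>_. 0)"
proof -
  have "(fdiff ^^ e) a = (fdiff ^^ (e - d)) ((fdiff ^^ d) a)"
    using assms(2) by (metis comp_apply funpow_add le_add_diff_inverse2)
  then show ?thesis using assms(1) by simp
qed

text \<open>The induction runs over the total order \<open>d + e\<close> and uses the discrete product rule, both summands of
which have a smaller total order.\<close>

lemma funpow_fdiff_mult:
  assumes "(fdiff ^^ d) a = (\<lambda>_. 0)" "(fdiff ^^ e) b = (\<lambda>_. 0)"
  shows "(fdiff ^^ (d + e)) (\<lambda>M. a M * b M) = (\<lambda>_. 0)"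
  using assms
proof (induction "d + e" arbitrary: d e a b)
  case 0
  then show ?case by (simp add: fun_eq_iff)
next
  case (Suc s)
  show ?case
  proof (cases "d = 0 \<or> e = 0")
    case True
    then have "(\<lambda>M. a M * b M) = (\<lambda>_. 0)" using Suc.prems by (auto simp: fun_eq_iff)
    then show ?thesis by simp
  next
    case False
    then obtain d' e' where de: "d = Suc d'" "e = Suc e'" by (metis not0_implies_Suc)
    have step: "fdiff (\<lambda>M. a M * b M) = (\<lambda>M. a (Suc M) * fdiff b M + fdiff a M * b M)"
      by (simp add: fdiff_def fun_eq_iff algebra_simps)
    have "(fdiff ^^ (d + e')) (\<lambda>M. a (Suc M) * fdiff b M) = (\<lambda>_. 0)"
    proof (rule Suc.hyps(1))
      show "(fdiff ^^ d) (\<lambda>M. a (Suc M)) = (\<lambda>_. 0)"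
        unfolding funpow_fdiff_shift using Suc.prems by simp
      show "(fdiff ^^ e') (fdiff b) = (\<lambda>_. 0)"
        using Suc.prems(2) by (simp add: de funpow_Suc_right del: funpow.simps)
    qed (use Suc.hyps(2) de in simp)
    moreover have "(fdiff ^^ (d' + e)) (\<lambda>M. fdiff a M * b M) = (\<lambda>_. 0)"
    proof (rule Suc.hyps(1))
      show "(fdiff ^^ d') (fdiff a) = (\<lambda>_. 0)"
        using Suc.prems(1) by (simp add: de funpow_Suc_right del: funpow.simps)
    qed (use Suc.hyps(2) Suc.prems de in simp_all)
    ultimately have "(fdiff ^^ s) (fdiff (\<lambda>M. a M * b M)) = (\<lambda>_. 0)"
      using Suc.hyps(2) de unfolding step funpow_fdiff_add by simp
    then show ?thesis
      by (simp add: Suc.hyps(2)[symmetric] funpow_Suc_right del: funpow.simps)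
  qed
qed

lemma polynomial_seq_const: "polynomial_seq (\<lambda>_. c)"
  unfolding polynomial_seq_def by (rule exI[of _ 1]) (simp add: fdiff_def fun_eq_iff)

lemma polynomial_seq_add:
  assumes "polynomial_seq a" "polynomial_seq b"
  shows "polynomial_seq (\<lambda>M. a M + b M)"
proof -
  from assms obtain d e where
    "(fdiff ^^ d) a = (\<lambda>_. 0)" "(fdiff ^^ e) b = (\<lambda>_. 0)" by (auto simp: polynomial_seq_def)
  then have "(fdiff ^^ (max d e)) a = (\<lambda>_. 0)" "(fdiff ^^ (max d e)) b = (\<lambda>_. 0)"
    by (auto intro: funpow_fdiff_mono)
  then show ?thesis
    unfolding polynomial_seq_def by (intro exI[of _ "max d e"]) (simp add: funpow_fdiff_add)
qed

lemma polynomial_seq_mult: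
  "polynomial_seq a \<Longrightarrow> polynomial_seq b \<Longrightarrow> polynomial_seq (\<lambda>M. a M * b M)"
  unfolding polynomial_seq_def using funpow_fdiff_mult by blast

lemma polynomial_seq_sum:
  "(\<And>i. i \<in> I \<Longrightarrow> polynomial_seq (a i)) \<Longrightarrow> polynomial_seq (\<lambda>M. \<Sum>i\<in>I. a i M)"
  by (induction I rule: infinite_finite_induct)
     (simp_all add: polynomial_seq_const polynomial_seq_add)

lemma polynomial_seq_prod_list:
  "(\<And>i. i \<in> set xs \<Longrightarrow> polynomial_seq (a i)) \<Longrightarrow>
     polynomial_seq (\<lambda>M. prod_list (map (\<lambda>i. a i M) xs))"
  by (induction xs) (simp_all add: polynomial_seq_const polynomial_seq_mult)

lemma polynomial_seq_fdiffI: "polynomial_seq (fdiff a) \<Longrightarrow> polynomial_seq a"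
  unfolding polynomial_seq_def by (metis comp_apply funpow_Suc_right)

text \<open>If \<open>a\<close> vanishes from 1 on, then so do its differences. By induction on the order of the vanishing
difference, the first difference also vanishes at 0.\<close>

lemma polynomial_seq_extend_zero:
  assumes "polynomial_seq a" "\<And>M. a (Suc M) = 0"
  shows "a 0 = 0"
proof -
  have "a 0 = 0" if "(fdiff ^^ d) a = (\<lambda>_. 0)" "\<And>M. a (Suc M) = 0" for d
    using that
  proof (induction d arbitrary: a)
    case (Suc d)
    have "fdiff a 0 = 0"
    proof (rule Suc.IH)
      show "(fdiff ^^ d) (fdiff a) = (\<lambda>_. 0)"
        using Suc.prems(1) by (simp add: funpow_Suc_right del: funpow.simps)
    qed (simp add: fdiff_def Suc.prems(2))
    then show ?case by (simp add: fdiff_def Suc.prems(2))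
  qed (simp add: fun_eq_iff)
  then show ?thesis using assms by (auto simp: polynomial_seq_def)
qed

lemma polynomial_seq_extend:
  assumes "polynomial_seq a" "polynomial_seq b" "\<And>M. a (Suc M) = b (Suc M)"
  shows "a 0 = b 0"
proof -
  have "polynomial_seq (\<lambda>M. a M + (- 1) * b M)"
    using assms by (intro polynomial_seq_add polynomial_seq_mult polynomial_seq_const)
  then have "a 0 + (- 1) * b 0 = 0"
    by (rule polynomial_seq_extend_zero) (simp add: assms)
  then show ?thesis by simp
qed

text \<open>The difference in \<open>M\<close> is the coefficient of \<open>AB\<^sup>M(B - 1)\<close>. Since \<open>B - 1\<close> has no constant term, only
lower coefficients of \<open>AB\<^sup>M\<close> enter, to which induction applies.\<close>

lemma polynomial_seq_fps_power:
  fixes A B :: "'a::comm_ring_1 fps"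
  assumes "B $ 0 = 1"
  shows "polynomial_seq (\<lambda>M. (A * B ^ M) $ n)"
proof (induction n rule: less_induct)
  case (less n)
  have "fdiff (\<lambda>M. (A * B ^ M) $ n) =
      (\<lambda>M. \<Sum>i\<in>{..<n}. (A * B ^ M) $ i * (B - 1) $ (n - i))"
  proof
    fix M
    have "fdiff (\<lambda>M. (A * B ^ M) $ n) M = ((A * B ^ M) * (B - 1)) $ n"
      by (simp only: fdiff_def power_Suc2 mult.assoc[symmetric] right_diff_distrib mult_1_right
          fps_sub_nth)
    also have "\<dots> = (\<Sum>i\<in>{0..n}. (A * B ^ M) $ i * (B - 1) $ (n - i))"
      by (rule fps_mult_nth)
    also have "\<dots> = (\<Sum>i\<in>{..<n}. (A * B ^ M) $ i * (B - 1) $ (n - i))"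
    proof -
      have "{0..n} = insert n {..<n}" by auto
      then show ?thesis using assms by simp
    qed
    finally show "fdiff (\<lambda>M. (A * B ^ M) $ n) M =
      (\<Sum>i\<in>{..<n}. (A * B ^ M) $ i * (B - 1) $ (n - i))" .
  qed
  moreover have "polynomial_seq \<dots>"
    by (rule polynomial_seq_sum, rule polynomial_seq_mult[OF less polynomial_seq_const]) simp
  ultimately show ?case by (rule polynomial_seq_fdiffI[OF subst[OF sym, of _ _ polynomial_seq]])
qed

section \<open>Schur functions in one even and one odd variable\<close>

text \<open>A weight that is a product over the rows can be summed row by row, since the choices of the rows are
independent.\<close>

lemma strips_sum_Cons:
  fixes y :: "'a::comm_ring_1"
  assumes "\<And>c m. F (c # m) = u c * v m"
  shows "(\<Sum>mu\<in>strips (a # b # l). y ^ (sum_list (a # b # l) - sum_list mu) * F mu) =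
    (\<Sum>c=b..a. y ^ (a - c) * u c) *
    (\<Sum>m\<in>strips (b # l). y ^ (sum_list (b # l) - sum_list m) * v m)"
proof -
  have "(\<Sum>mu\<in>strips (a # b # l). y ^ (sum_list (a # b # l) - sum_list mu) * F mu) =
      (\<Sum>(c, m)\<in>{b..a} \<times> strips (b # l).
        y ^ (sum_list (a # b # l) - sum_list (c # m)) * F (c # m))"
    by (simp only: strips.simps, subst sum.reindex)
       (auto simp: inj_on_def case_prod_unfold)
  also have "\<dots> = (\<Sum>(c, m)\<in>{b..a} \<times> strips (b # l).
      (y ^ (a - c) * u c) * (y ^ (sum_list (b # l) - sum_list m) * v m))"
  proof (rule sum.cong, simp, clarify)
    fix c m assume "c \<in> {b..a}" and m: "m \<in> strips (b # l)"
    then have "sum_list (a # b # l) - sum_list (c # m) =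
        (a - c) + (sum_list (b # l) - sum_list m)"
      using strips_sum_list_le[OF m] by simp
    then show "y ^ (sum_list (a # b # l) - sum_list (c # m)) * F (c # m) =
        (y ^ (a - c) * u c) * (y ^ (sum_list (b # l) - sum_list m) * v m)"
      by (simp only: assms power_add mult_ac)
  qed
  also have "\<dots> = (\<Sum>c=b..a. y ^ (a - c) * u c) *
      (\<Sum>m\<in>strips (b # l). y ^ (sum_list (b # l) - sum_list m) * v m)"
    by (simp add: sum_product sum.cartesian_product)
  finally show ?thesis .
qed

lemma schur_sum_Nil [simp]: "schur_sum z N [] = 1"
  by (induction N) (simp_all add: schur_sum_0 schur_sum_branching)

text \<open>The empty shape can be reached by removing a single horizontal strip only from a shape with at most one row.\<close>

lemma empty_strip_sum:
  fixes y :: "'a::comm_ring_1"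
  shows "(\<Sum>m\<in>strips (k # l). y ^ (sum_list (k # l) - sum_list m) *
      (if sum_list m = 0 then 1 else 0)) = (if sum_list l = 0 then y ^ k else 0)"
proof (induction l arbitrary: k)
  case Nil
  show ?case by (simp add: sum.reindex inj_on_def if_distrib cong: if_cong)
next
  case (Cons b l)
  have "(\<Sum>m\<in>strips (k # b # l). y ^ (sum_list (k # b # l) - sum_list m) *
      (if sum_list m = 0 then 1 else 0)) =
      (\<Sum>c=b..k. y ^ (k - c) * (if c = 0 then 1 else 0)) *
      (if sum_list l = 0 then y ^ b else 0)"
    by (subst strips_sum_Cons[where u = "\<lambda>c. if c = 0 then 1 else 0"
          and v = "\<lambda>m. if sum_list m = 0 then 1 else 0"], simp, subst Cons, rule refl)
  then show ?case by (cases "b = 0") (auto simp: if_distrib cong: if_cong)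
qed

lemma schur_sum_one_variable:
  assumes "sorted_wrt (\<ge>) (k # l)"
  shows "schur_sum z (Suc 0) (k # l) = (if sum_list l = 0 then z 0 ^ k else 0)"
  unfolding schur_sum_branching[OF assms] schur_sum_0 by (rule empty_strip_sum)

text \<open>The shape left after the first strip has at most one row; its length \<open>a\<close> ranges from \<open>d\<close> to \<open>c\<close>.\<close>

lemma schur_sum_two_variables:
  assumes "sorted_wrt (\<ge>) (c # d # l)"
  shows "schur_sum z (Suc (Suc 0)) (c # d # l) =
    (\<Sum>a=d..c. z 1 ^ (c - a) * z 0 ^ a) * (if sum_list l = 0 then z 1 ^ d else 0)"
proof -
  have "schur_sum z (Suc (Suc 0)) (c # d # l) =
      (\<Sum>mu\<in>strips (c # d # l). z 1 ^ (sum_list (c # d # l) - sum_list mu) *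
        (z 0 ^ hd mu * (if sum_list (tl mu) = 0 then 1 else 0)))"
    unfolding schur_sum_branching[OF assms]
  proof (rule sum.cong, rule refl)
    fix mu assume mu: "mu \<in> strips (c # d # l)"
    then obtain e m where e: "mu = e # m" by auto
    show "z (Suc 0) ^ (sum_list (c # d # l) - sum_list mu) * schur_sum z (Suc 0) mu =
        z 1 ^ (sum_list (c # d # l) - sum_list mu) *
          (z 0 ^ hd mu * (if sum_list (tl mu) = 0 then 1 else 0))"
      using strips_sorted[OF assms mu] unfolding e
      by (subst schur_sum_one_variable) auto
  qed
  also have "\<dots> = (\<Sum>a=d..c. z 1 ^ (c - a) * z 0 ^ a) *
      (if sum_list l = 0 then z 1 ^ d else 0)"
    by (subst strips_sum_Cons[where u = "\<lambda>a. z 0 ^ a"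
          and v = "\<lambda>m. if sum_list m = 0 then 1 else 0"], simp, subst empty_strip_sum, rule refl)
  finally show ?thesis .
qed

definition X :: bipoly where "X = [:[:0, 1:]:]"
definition Y :: bipoly where "Y = [:0, 1:]"

text \<open>The factors that the first row and the later rows contribute to the value of a hook. A later row of
length at least 2 contributes 0, so all other shapes get the value 0. For a first row of length 0
(the empty shape) the factor must be 1.\<close>

definition arm_factor :: "nat \<Rightarrow> bipoly" where
  "arm_factor k = (if k = 0 then 1 else X ^ (k - 1) * (X - Y))"

definition leg_factor :: "nat \<Rightarrow> bipoly" where
  "leg_factor c = (if c = 0 then 1 else if c = 1 then - Y else 0)"

fun hook_value :: "nat list \<Rightarrow> bipoly" where
  "hook_value [] = 1"
| "hook_value (k # l) = arm_factor k * prod_list (map leg_factor l)"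

text \<open>The sum telescopes: \<open>arm_factor c\<close> is \<open>X\<^sup>c - X\<^bsup>c-1\<^esup>Y\<close> for \<open>c > 0\<close>.\<close>

lemma arm_factor_sum: "(\<Sum>c=0..a. Y ^ (a - c) * arm_factor c) = X ^ a"
proof (induction a)
  case (Suc a)
  have "(\<Sum>c=0..Suc a. Y ^ (Suc a - c) * arm_factor c) =
      (\<Sum>c=0..a. Y * (Y ^ (a - c) * arm_factor c)) + arm_factor (Suc a)"
    by (simp add: Suc_diff_le mult.assoc)
  also have "\<dots> = X ^ Suc a"
    unfolding sum_distrib_left[symmetric] Suc by (simp add: arm_factor_def algebra_simps)
  finally show ?case .
qed (simp add: arm_factor_def)

lemma leg_factor_sum:
  "(\<Sum>c=0..a. Y ^ (a - c) * leg_factor c) = (if a = 0 then 1 else 0)"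
proof (cases a)
  case (Suc b)
  have "(\<Sum>c=0..a. Y ^ (a - c) * leg_factor c) = (\<Sum>c\<in>{0, 1}. Y ^ (a - c) * leg_factor c)"
    by (rule sum.mono_neutral_right) (auto simp: leg_factor_def Suc)
  then show ?thesis by (simp add: leg_factor_def Suc)
qed (simp add: leg_factor_def)

text \<open>The last nonempty row may be cut down to one box or removed. Both choices give the same power
of \<open>Y\<close> with opposite signs, whatever happens in the other rows, so only an empty shape survives.\<close>

lemma leg_strip_sum:
  "(\<Sum>m\<in>strips l. Y ^ (sum_list l - sum_list m) * prod_list (map leg_factor m)) =
     (if sum_list l = 0 then 1 else 0)"
proof (induction l rule: strips.induct)
  case (2 a)
  show ?case using leg_factor_sum[of a] by (simp add: sum.reindex inj_on_def)
next
  case (3 a b l)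
  show ?case
    by (subst strips_sum_Cons[where u = leg_factor and v = "\<lambda>m. prod_list (map leg_factor m)"],
        simp, subst 3) (use leg_factor_sum[of a] in auto)
qed simp

text \<open>Adding one variable \<open>Y\<close> to the hook values leaves the Schur function of the single variable \<open>X\<close>. So
the hook values belong to the alphabet \<open>X\<close> with one \<open>Y\<close> taken away.\<close>

lemma hook_strip_sum:
  assumes "sorted_wrt (\<ge>) lam" "z 0 = X"
  shows "(\<Sum>mu\<in>strips lam. Y ^ (sum_list lam - sum_list mu) * hook_value mu) =
     schur_sum z (Suc 0) lam"
proof (cases lam)
  case (Cons a l)
  have one: "schur_sum z (Suc 0) lam = (if sum_list l = 0 then X ^ a else 0)"
    using assms unfolding Cons by (subst schur_sum_one_variable) auto
  show ?thesis
  proof (cases l)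
    case Nil
    then show ?thesis
      unfolding one using arm_factor_sum[of a] by (simp add: Cons sum.reindex inj_on_def)
  next
    case (Cons b l')
    show ?thesis
      unfolding \<open>lam = a # l\<close> Cons one[unfolded \<open>lam = a # l\<close> Cons]
      by (subst strips_sum_Cons[where u = arm_factor and v = "\<lambda>m. prod_list (map leg_factor m)"],
          simp, subst leg_strip_sum) (use arm_factor_sum[of a] in auto)
  qed
qed simp

definition super_var :: "nat \<Rightarrow> bipoly" where
  "super_var i = (if i = 0 then X else Y)"

text \<open>For positive \<open>M\<close> the alphabet has one \<open>X\<close> and \<open>M - 1\<close> copies of \<open>Y\<close>; for \<open>M = 0\<close> it has
formally \<open>-1\<close> copies.\<close>

definition super_schur :: "nat list \<Rightarrow> nat \<Rightarrow> bipoly" where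
  "super_schur lam M = (if M = 0 then hook_value lam else schur_sum super_var M lam)"

lemma super_schur_Suc:
  assumes "sorted_wrt (\<ge>) lam"
  shows "super_schur lam (Suc M) =
    (\<Sum>mu\<in>strips lam. Y ^ (sum_list lam - sum_list mu) * super_schur mu M)"
proof (cases M)
  case 0
  then show ?thesis
    using hook_strip_sum[OF assms, of super_var] by (simp add: super_schur_def super_var_def)
next
  case (Suc M')
  then show ?thesis
    using schur_sum_branching[OF assms, of super_var M] by (simp add: super_schur_def super_var_def)
qed

text \<open>The branching rule expresses the difference in \<open>M\<close> by strictly smaller shapes, as the term with the
empty strip cancels.\<close>

lemma polynomial_seq_super_schur:
  "sorted_wrt (\<ge>) lam \<Longrightarrow> polynomial_seq (super_schur lam)"
proof (induction "sum_list lam" arbitrary: lam rule: less_induct)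
  case less
  have "fdiff (super_schur lam) =
      (\<lambda>M. \<Sum>mu\<in>strips lam - {lam}. Y ^ (sum_list lam - sum_list mu) * super_schur mu M)"
  proof
    fix M
    show "fdiff (super_schur lam) M =
      (\<Sum>mu\<in>strips lam - {lam}. Y ^ (sum_list lam - sum_list mu) * super_schur mu M)"
      unfolding fdiff_def super_schur_Suc[OF less.prems]
      by (subst sum.remove[OF finite_strips strips_self[OF less.prems]]) simp
  qed
  moreover have "polynomial_seq (super_schur mu)" if mu: "mu \<in> strips lam - {lam}" for mu
  proof (rule less.hyps)
    show "sum_list mu < sum_list lam"
      using mu strips_sum_list_le[of mu lam] strips_sum_list_eqD[of mu lam] by fastforce
    show "sorted_wrt (\<ge>) mu" using strips_sorted[OF less.prems] mu by blast
  qed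
  ultimately have "polynomial_seq (fdiff (super_schur lam))"
    by (simp only: polynomial_seq_sum polynomial_seq_mult polynomial_seq_const)
  then show ?case by (rule polynomial_seq_fdiffI)
qed

section \<open>The specialized Frobenius formula\<close>

lemma linear_ratio_inverse:
  assumes "t \<noteq> 0"
  shows "linear_ratio t a * linear_ratio (inverse t) (scalar t * a) = 1"
proof -
  have "scalar (inverse t) * (scalar t * a) = a"
    using assms by (simp add: mult.assoc[symmetric] scalar_simps(6)[symmetric] del: scalar_simps(6))
  then have "(1 - fps_const a * fps_X) * (linear_ratio t a * linear_ratio (inverse t) (scalar t * a)) =
      (1 - fps_const a * fps_X) * 1"
    using linear_ratio_mult[of a t] linear_ratio_mult[of "scalar t * a" "inverse t"]
    by (simp add: mult.assoc[symmetric])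
  then show ?thesis using one_minus_X_nonzero[of a] mult_left_cancel by blast
qed

lemma partitionsD:
  assumes "lam \<in> partitions k"
  shows "sorted_wrt (\<ge>) lam" "0 \<notin> set lam" "sum_list lam = k"
  using assms by (auto simp: partitions_def)

lemma frobenius_value:
  assumes "q_rook_characters chi" "mu \<in> partitions n"
  shows "scalar (q_indet ^ n / (q_indet - 1) ^ length mu) *
      prod_list (map (\<lambda>k. (linear_ratio (inverse q_indet) 1 *
        (\<Prod>i<N. linear_ratio (inverse q_indet) (z i))) $ k) mu) =
    (\<Sum>k=0..n. \<Sum>lam\<in>partitions k. scalar (chi lam mu) * schur_sum z N lam)"
proof -
  have "mpol_value z (const (q_indet ^ n / (q_indet - 1) ^ length mu) *
        q_hat_part N mu (inverse q_indet)) =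
      mpol_value z (\<Sum>k=0..n. \<Sum>lam\<in>partitions k. const (chi lam mu) * schur N lam)"
    using assms unfolding q_rook_characters_def by (metis (no_types, lifting))
  then show ?thesis
    by (simp only: mpol_value_mult mpol_value_sum mpol_value_const q_hat_part_value mpol_value_schur)
qed

lemma q_indet_nonzero [simp]: "q_indet \<noteq> 0"
  by (simp add: q_indet_def Zero_fract_def eq_fract)

text \<open>For \<open>M + 1\<close> variables the left side is built from \<open>AB\<^bsup>M+1\<^esup>\<close>, where \<open>B\<close> is the series of the variable
\<open>Y\<close> and \<open>A\<close> contains the inverse of \<open>B\<close>. Continuation to exponent 0 leaves only \<open>A\<close>.\<close>

lemma frobenius_super_value:
  assumes chi: "q_rook_characters chi" and mu: "mu \<in> partitions n"
  shows "scalar (q_indet ^ n / (q_indet - 1) ^ length mu) *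
      prod_list (map (\<lambda>k. (linear_ratio (inverse q_indet) X * (linear_ratio (inverse q_indet) 1 *
        linear_ratio q_indet (scalar (inverse q_indet) * Y))) $ k) mu) =
    (\<Sum>k=0..n. \<Sum>lam\<in>partitions k. scalar (chi lam mu) * hook_value lam)"
proof -
  define t where "t = inverse q_indet"
  define B where "B = linear_ratio t Y"
  define A where "A = linear_ratio t X * (linear_ratio t 1 * linear_ratio q_indet (scalar t * Y))"
  define c where "c = scalar (q_indet ^ n / (q_indet - 1) ^ length mu)"
  define lhs where "lhs M = c * prod_list (map (\<lambda>k. (A * B ^ M) $ k) mu)" for M
  define rhs where
    "rhs M = (\<Sum>k=0..n. \<Sum>lam\<in>partitions k. scalar (chi lam mu) * super_schur lam M)" for M
  have B0: "B $ 0 = 1" by (simp add: B_def linear_ratio_def)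
  have "polynomial_seq lhs"
    unfolding lhs_def
    by (intro polynomial_seq_mult polynomial_seq_const polynomial_seq_prod_list
        polynomial_seq_fps_power B0)
  moreover have "polynomial_seq rhs"
    unfolding rhs_def
    by (intro polynomial_seq_sum polynomial_seq_mult polynomial_seq_const
        polynomial_seq_super_schur partitionsD(1))
  moreover have "lhs (Suc M) = rhs (Suc M)" for M
  proof -
    have BA: "B * linear_ratio q_indet (scalar t * Y) = 1"
      using linear_ratio_inverse[of t Y] by (simp add: B_def t_def)
    have "A * B ^ Suc M = linear_ratio t X * linear_ratio t 1 *
        (B * linear_ratio q_indet (scalar t * Y)) * B ^ M"
      by (simp only: A_def power_Suc mult_ac)
    also have "\<dots> = linear_ratio t 1 * (\<Prod>i<Suc M. linear_ratio t (super_var i))"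
    proof -
      have "(\<Prod>i<M. linear_ratio t (super_var (Suc i))) = B ^ M"
        by (simp add: super_var_def B_def)
      then show ?thesis
        unfolding BA prod.lessThan_Suc_shift comp_def by (simp add: super_var_def mult_ac)
    qed
    finally have "lhs (Suc M) = c * prod_list (map (\<lambda>k. (linear_ratio t 1 *
        (\<Prod>i<Suc M. linear_ratio t (super_var i))) $ k) mu)"
      by (simp only: lhs_def)
    also have "\<dots> = rhs (Suc M)"
      unfolding c_def t_def frobenius_value[OF chi mu] rhs_def super_schur_def
      by (simp only: nat.distinct if_False)
    finally show ?thesis .
  qed
  ultimately have "lhs 0 = rhs 0" by (rule polynomial_seq_extend)
  then show ?thesis
    by (simp only: lhs_def rhs_def super_schur_def A_def c_def t_def power_0 mult_1_right simp_thms if_True)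
qed

section \<open>Extraction of coefficients\<close>

text \<open>The compositions \<open>\<tau> \<subset> \<mu>\<close> of all sizes, i.e. the union of the \<open>subcompositions\<close>.\<close>

definition contained_lists :: "nat list \<Rightarrow> nat list set" where
  "contained_lists mu = {tau. list_all2 (\<le>) tau mu}"

lemma contained_lists_Nil: "contained_lists [] = {[]}"
  by (simp add: contained_lists_def)

lemma contained_lists_Cons: "contained_lists (k # mu) = (\<lambda>(c, tau). c # tau) ` ({0..k} \<times> contained_lists mu)"
  by (auto simp: contained_lists_def list_all2_Cons2)

lemma finite_contained_lists [simp]: "finite (contained_lists mu)"
  by (induction mu) (simp_all add: contained_lists_Nil contained_lists_Cons)

lemma subcompositions_eq: "subcompositions mu k = {tau \<in> contained_lists mu. int (sum_list tau) = k}"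
  by (auto simp: subcompositions_def contained_lists_def list_all2_conv_all_nth)

lemma sum_list_diff:
  "tau \<in> contained_lists mu \<Longrightarrow> sum_list tau + sum_list (list_diff mu tau) = sum_list mu"
  by (induction mu arbitrary: tau) (auto simp: contained_lists_Nil contained_lists_Cons list_diff_def)

lemma prod_list_fps_mult:
  fixes f g :: "'a::comm_ring_1 fps"
  shows "prod_list (map (\<lambda>n. (f * g) $ n) mu) =
    (\<Sum>tau\<in>contained_lists mu. prod_list (map (($) f) tau) * prod_list (map (($) g) (list_diff mu tau)))"
proof (induction mu)
  case Nil
  show ?case by (simp add: contained_lists_Nil list_diff_def)
next
  case (Cons k mu)
  let ?F = "\<lambda>tau mu. prod_list (map (($) f) tau) * prod_list (map (($) g) (list_diff mu tau))"
  have "prod_list (map (\<lambda>n. (f * g) $ n) (k # mu)) =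
      (\<Sum>i=0..k. f $ i * g $ (k - i)) * (\<Sum>tau\<in>contained_lists mu. ?F tau mu)"
    by (simp only: list.map prod_list.Cons Cons fps_mult_nth[of f g k])
  also have "\<dots> = (\<Sum>(i, tau)\<in>{0..k} \<times> contained_lists mu. f $ i * g $ (k - i) * ?F tau mu)"
    by (simp only: sum_product sum.cartesian_product)
  also have "\<dots> = (\<Sum>tau\<in>contained_lists (k # mu). ?F tau (k # mu))"
    unfolding contained_lists_Cons
    by (subst sum.reindex) (auto simp: inj_on_def list_diff_def mult_ac intro!: sum.cong)
  finally show ?case .
qed

text \<open>Every part of \<open>\<mu>\<close> is distributed among the three factors; collecting the shares of all parts gives
three compositions.\<close>

lemma prod_list_fps_mult3:
  fixes f g h :: "'a::comm_ring_1 fps"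
  shows "prod_list (map (\<lambda>n. (f * (g * h)) $ n) mu) =
    (\<Sum>tau\<in>contained_lists mu. \<Sum>theta\<in>contained_lists (list_diff mu tau).
      prod_list (map (($) f) tau) * prod_list (map (($) g) theta) *
      prod_list (map (($) h) (list_diff (list_diff mu tau) theta)))"
  by (simp only: prod_list_fps_mult[of f "g * h"] prod_list_fps_mult[of g h]
      sum_distrib_left mult.assoc)

lemma prod_list_linear_ratio:
  "prod_list (map (($) (linear_ratio t a)) tau) =
     scalar ((1 - t) ^ nonzero_length tau) * a ^ sum_list tau"
  by (induction tau)
     (simp_all add: linear_ratio_def nonzero_length_def power_add mult_ac)

text \<open>The coefficient of \<open>X\<^sup>i Y\<^sup>j\<close>: in \<^typ>\<open>bipoly\<close> the outer variable is \<open>Y\<close>.\<close>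

definition coeff_XY :: "bipoly \<Rightarrow> nat \<Rightarrow> nat \<Rightarrow> ratfun" where
  "coeff_XY P i j = coeff (coeff P j) i"

lemma coeff_XY_0 [simp]: "coeff_XY 0 i j = 0"
  and coeff_XY_add: "coeff_XY (P + Q) i j = coeff_XY P i j + coeff_XY Q i j"
  and coeff_XY_diff: "coeff_XY (P - Q) i j = coeff_XY P i j - coeff_XY Q i j"
  by (simp_all add: coeff_XY_def)

lemma coeff_XY_sum: "coeff_XY (\<Sum>a\<in>A. f a) i j = (\<Sum>a\<in>A. coeff_XY (f a) i j)"
  by (induction A rule: infinite_finite_induct) (simp_all add: coeff_XY_add)

lemma coeff_XY_scalar: "coeff_XY (scalar c * P) i j = c * coeff_XY P i j"
  by (simp add: coeff_XY_def scalar_def)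

lemma coeff_XY_monomial:
  "coeff_XY (X ^ a * Y ^ b) i j = (if a = i \<and> b = j then 1 else 0)"
proof -
  have X: "X ^ a = [:monom 1 a:]"
    by (simp add: X_def monom_altdef poly_const_pow)
  have "Y ^ b = monom 1 b" by (simp add: Y_def monom_altdef)
  then show ?thesis by (simp add: X coeff_XY_def)
qed

lemma finite_partitions [simp]: "finite (partitions n)"
proof (rule finite_subset)
  have len: "length xs \<le> sum_list xs" if "0 \<notin> set xs" for xs :: "nat list"
    using that by (induction xs) auto
  show "partitions n \<subseteq> {xs. set xs \<subseteq> {..n} \<and> length xs \<le> n}"
  proof
    fix xs assume "xs \<in> partitions n"
    then have "0 \<notin> set xs" "sum_list xs = n" by (auto dest: partitionsD)
    with len[of xs] member_le_sum_list[of _ xs]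
    show "xs \<in> {xs. set xs \<subseteq> {..n} \<and> length xs \<le> n}" by blast
  qed
qed (simp add: finite_lists_length_le)

lemma sum_pick_partition:
  fixes f :: "nat list \<Rightarrow> 'a::comm_ring_1"
  assumes "lam \<in> partitions m" "m \<le> n"
  shows "(\<Sum>k=0..n. \<Sum>kappa\<in>partitions k. f kappa * (if kappa = lam then c else 0)) = f lam * c"
proof -
  have "(\<Sum>kappa\<in>partitions k. f kappa * (if kappa = lam then c else 0)) =
      (if k = m then f lam * c else 0)" for k
  proof (cases "k = m")
    case True
    have "(\<Sum>kappa\<in>partitions k. f kappa * (if kappa = lam then c else 0)) =
        (\<Sum>kappa\<in>partitions k. if kappa = lam then f lam * c else 0)"
      by (rule sum.cong) auto
    then show ?thesis using True assms(1) by simp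
  next
    case False
    then have "lam \<notin> partitions k"
      using partitionsD(3)[of lam k] partitionsD(3)[OF assms(1)] by blast
    then have "(\<Sum>kappa\<in>partitions k. f kappa * (if kappa = lam then c else 0)) = 0"
      by (intro sum.neutral) auto
    then show ?thesis using False by simp
  qed
  then show ?thesis using assms(2) by simp
qed

section \<open>Hook characters\<close>

lemma hook_partition: "1 \<le> k \<Longrightarrow> hook k r \<in> partitions (k + r)"
proof -
  assume "1 \<le> k"
  moreover have "sorted_wrt (\<ge>) (replicate r (1 :: nat))" by (induction r) auto
  ultimately show ?thesis by (auto simp: hook_def partitions_def sum_list_replicate)
qed

lemma hook_value_hook:
  assumes "1 \<le> k"
  shows "hook_value (hook k r) =
    scalar ((- 1) ^ r) * (X ^ k * Y ^ r) - scalar ((- 1) ^ r) * (X ^ (k - 1) * Y ^ (r + 1))"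
proof -
  have "(- Y) ^ r = scalar ((- 1) ^ r) * Y ^ r"
    by (simp add: power_minus[of Y])
  moreover obtain j where "k = Suc j" using assms by (cases k) simp_all
  ultimately show ?thesis
    by (simp add: hook_def arm_factor_def leg_factor_def algebra_simps del: scalar_power)
qed

lemma hook_value_not_hook:
  assumes "lam \<in> partitions m" "lam \<noteq> []" "\<And>k r. 1 \<le> k \<Longrightarrow> lam \<noteq> hook k r"
  shows "hook_value lam = 0"
proof -
  obtain k l where lam: "lam = k # l" using assms(2) by (cases lam) auto
  have pos: "1 \<le> k" "0 \<notin> set l" using partitionsD(2)[OF assms(1)] lam by (auto simp: Suc_le_eq)
  have "\<not> (\<forall>x\<in>set l. x = 1)"
    using assms(3)[OF pos(1), of "length l"] replicate_length_same[of l 1]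
    by (auto simp: lam hook_def)
  then obtain x where "x \<in> set l" "x \<noteq> 1" by blast
  then have "0 \<in> set (map leg_factor l)"
    using pos(2) by (force simp: leg_factor_def)
  then have "prod_list (map leg_factor l) = 0"
    by (simp add: prod_list_zero_iff)
  then show ?thesis by (simp add: lam)
qed

text \<open>A hook of size \<open>m\<close> contributes two monomials of degree \<open>m\<close> with opposite signs, of degrees \<open>a\<close> and
\<open>a - 1\<close> in \<open>X\<close>, where \<open>a\<close> is its first row. The window from \<open>k\<close> to \<open>m\<close> contains exactly one of
them iff \<open>a = k\<close>.\<close>

lemma hook_value_coeff_sum:
  assumes "1 \<le> k" "k \<le> m" "lam \<in> partitions p"
  shows "(\<Sum>i=k..m. coeff_XY (hook_value lam) i (m - i)) =
    (if lam = hook k (m - k) then (- 1) ^ (m - k) else 0)"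
proof (cases "\<exists>a r. 1 \<le> a \<and> lam = hook a r")
  case True
  then obtain a r where a: "1 \<le> a" and lam: "lam = hook a r" by blast
  have "(\<Sum>i=k..m. coeff_XY (hook_value lam) i (m - i)) =
      (- 1) ^ r * ((\<Sum>i=k..m. if a = i then (if r = m - i then 1 else 0) else 0) -
        (\<Sum>i=k..m. if a - 1 = i then (if r + 1 = m - i then 1 else 0) else 0))"
    unfolding lam hook_value_hook[OF a] coeff_XY_diff coeff_XY_scalar coeff_XY_monomial
      sum_subtractf[symmetric] sum_distrib_left
    by (rule sum.cong) (auto simp: algebra_simps)
  also have "\<dots> = (- 1) ^ r * ((if k \<le> a \<and> a \<le> m \<and> r = m - a then 1 else 0) -
      (if k \<le> a - 1 \<and> a - 1 \<le> m \<and> r + 1 = m - (a - 1) then 1 else 0))"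
    by (subst sum.delta', simp, subst sum.delta', simp) auto
  also have "\<dots> = (if a = k \<and> r = m - k then (- 1) ^ (m - k) else 0)"
    using a assms by auto
  finally show ?thesis
    by (auto simp: lam hook_def dest: arg_cong[where f = length])
next
  case False
  note no_hook = False
  then have "lam \<noteq> hook k (m - k)" using assms(1) by blast
  moreover have "coeff_XY (hook_value lam) i (m - i) = 0" if "k \<le> i" for i
  proof (cases "lam = []")
    case True
    then show ?thesis using that assms(1) coeff_XY_monomial[of 0 0 i "m - i"] by simp
  next
    case False
    then show ?thesis using hook_value_not_hook[OF assms(3)] no_hook by simp
  qed
  ultimately show ?thesis by simp
qed

lemma coeff_XY_sum_contained_lists:
  fixes F :: "nat list \<Rightarrow> nat list \<Rightarrow> ratfun"
  assumes "\<And>tau theta. tau \<in> contained_lists mu \<Longrightarrow> theta \<in> contained_lists (list_diff mu tau) \<Longrightarrow>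
      coeff_XY (G tau theta) i j =
        (if int (sum_list tau) = a \<and> int (sum_list theta) = b then F tau theta else 0)"
  shows "coeff_XY (\<Sum>tau\<in>contained_lists mu. \<Sum>theta\<in>contained_lists (list_diff mu tau). G tau theta) i j =
    (\<Sum>tau\<in>subcompositions mu a. \<Sum>theta\<in>subcompositions (list_diff mu tau) b. F tau theta)"
proof -
  have "(\<Sum>theta\<in>contained_lists (list_diff mu tau). coeff_XY (G tau theta) i j) =
      (if int (sum_list tau) = a
       then \<Sum>theta\<in>subcompositions (list_diff mu tau) b. F tau theta else 0)"
    if "tau \<in> contained_lists mu" for tau
    using assms[OF that] unfolding subcompositions_eq
    by (auto simp: sum.inter_filter intro!: sum.cong sum.neutral)
  then show ?thesis
    unfolding coeff_XY_sum subcompositions_eq[of mu] sum.inter_filter[OF finite_contained_lists]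
    by (intro sum.cong) auto
qed

text \<open>The three factors give \<open>\<tau>\<close> the variable \<open>X\<close>, \<open>\<theta>\<close> the value 1 and the rest \<open>tY\<close>. Thus the degree
\<open>m - i\<close> in \<open>Y\<close> is the size of \<open>\<mu> - \<tau> - \<theta>\<close>, so that \<open>\<theta>\<close> has size \<open>n - m\<close>, and the power of \<open>t\<close>
comes from the coefficient of \<open>Y\<close>.\<close>

lemma coeff_XY_super_product:
  assumes mu: "sum_list mu = n" and "i \<le> m" "m \<le> n" and t: "t = inverse q"
  shows "coeff_XY (prod_list (map (\<lambda>k. (linear_ratio t X * (linear_ratio t 1 *
        linear_ratio q (scalar t * Y))) $ k) mu)) i (m - i) =
    t ^ (m - i) * a_coeff mu (int i) (int n - int m) q"
proof -
  have "coeff_XY (prod_list (map (\<lambda>k. (linear_ratio t X * (linear_ratio t 1 *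
        linear_ratio q (scalar t * Y))) $ k) mu)) i (m - i) =
      (\<Sum>tau\<in>subcompositions mu (int i).
        \<Sum>theta\<in>subcompositions (list_diff mu tau) (int n - int m).
        t ^ (m - i) * ((1 - t) ^ (nonzero_length tau + nonzero_length theta) *
          (1 - q) ^ nonzero_length (list_diff (list_diff mu tau) theta)))"
    unfolding prod_list_fps_mult3 prod_list_linear_ratio
  proof (rule coeff_XY_sum_contained_lists)
    fix tau theta
    assume sub: "tau \<in> contained_lists mu" "theta \<in> contained_lists (list_diff mu tau)"
    let ?rho = "list_diff (list_diff mu tau) theta"
    let ?c = "(1 - t) ^ nonzero_length tau * (1 - t) ^ nonzero_length theta *
      (1 - q) ^ nonzero_length ?rho * t ^ sum_list ?rho"
    have n: "sum_list tau + sum_list theta + sum_list ?rho = n"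
      using sum_list_diff[OF sub(1)] sum_list_diff[OF sub(2)] mu by simp
    have "scalar ((1 - t) ^ nonzero_length tau) * X ^ sum_list tau *
        (scalar ((1 - t) ^ nonzero_length theta) * 1 ^ sum_list theta) *
        (scalar ((1 - q) ^ nonzero_length ?rho) * (scalar t * Y) ^ sum_list ?rho) =
        scalar ?c * (X ^ sum_list tau * Y ^ sum_list ?rho)"
      by (simp add: power_mult_distrib mult_ac)
    note product = this
    show "coeff_XY (scalar ((1 - t) ^ nonzero_length tau) * X ^ sum_list tau *
        (scalar ((1 - t) ^ nonzero_length theta) * 1 ^ sum_list theta) *
        (scalar ((1 - q) ^ nonzero_length ?rho) * (scalar t * Y) ^ sum_list ?rho)) i (m - i) =
        (if int (sum_list tau) = int i \<and> int (sum_list theta) = int n - int m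
         then t ^ (m - i) * ((1 - t) ^ (nonzero_length tau + nonzero_length theta) *
           (1 - q) ^ nonzero_length ?rho) else 0)"
      unfolding product coeff_XY_scalar coeff_XY_monomial
    proof (cases "sum_list tau = i \<and> sum_list ?rho = m - i")
      case True
      then have "int (sum_list tau) = int i \<and> int (sum_list theta) = int n - int m"
        using n assms(2,3) by auto
      with True show "?c * (if sum_list tau = i \<and> sum_list ?rho = m - i then 1 else 0) =
          (if int (sum_list tau) = int i \<and> int (sum_list theta) = int n - int m
           then t ^ (m - i) * ((1 - t) ^ (nonzero_length tau + nonzero_length theta) *
             (1 - q) ^ nonzero_length ?rho) else 0)"
        by (simp only: simp_thms if_True power_add mult_ac mult_1_right mult_1_left)
    next
      case False
      then have "\<not> (int (sum_list tau) = int i \<and> int (sum_list theta) = int n - int m)"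
        using n assms(2,3) by auto
      with False show "?c * (if sum_list tau = i \<and> sum_list ?rho = m - i then 1 else 0) =
          (if int (sum_list tau) = int i \<and> int (sum_list theta) = int n - int m
           then t ^ (m - i) * ((1 - t) ^ (nonzero_length tau + nonzero_length theta) *
             (1 - q) ^ nonzero_length ?rho) else 0)"
        by (simp only: if_False mult_zero_right)
    qed
  qed
  also have "\<dots> = t ^ (m - i) * a_coeff mu (int i) (int n - int m) q"
    using assms by (simp add: a_coeff_def sum_distrib_left)
  finally show ?thesis .
qed

lemma coeff_XY_two_variable_product:
  assumes mu: "sum_list mu = n" and "i + j \<le> n" and t: "t = inverse q"
  shows "coeff_XY (prod_list (map (\<lambda>k. (linear_ratio t X * (linear_ratio t Y *
        linear_ratio t 1)) $ k) mu)) i j = b_coeff mu (int i) (int j) q"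
proof -
  have "coeff_XY (prod_list (map (\<lambda>k. (linear_ratio t X * (linear_ratio t Y *
        linear_ratio t 1)) $ k) mu)) i j =
      (\<Sum>tau\<in>subcompositions mu (int i). \<Sum>theta\<in>subcompositions (list_diff mu tau) (int j).
        (1 - t) ^ (nonzero_length tau + nonzero_length theta +
          nonzero_length (list_diff (list_diff mu tau) theta)))"
    unfolding prod_list_fps_mult3 prod_list_linear_ratio
  proof (rule coeff_XY_sum_contained_lists)
    fix tau theta
    let ?rho = "list_diff (list_diff mu tau) theta"
    let ?c = "(1 - t) ^ (nonzero_length tau + nonzero_length theta + nonzero_length ?rho)"
    have "scalar ((1 - t) ^ nonzero_length tau) * X ^ sum_list tau *
        (scalar ((1 - t) ^ nonzero_length theta) * Y ^ sum_list theta) *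
        (scalar ((1 - t) ^ nonzero_length ?rho) * 1 ^ sum_list ?rho) =
        scalar ?c * (X ^ sum_list tau * Y ^ sum_list theta)"
      by (simp add: power_add mult_ac)
    note product = this
    show "coeff_XY (scalar ((1 - t) ^ nonzero_length tau) * X ^ sum_list tau *
        (scalar ((1 - t) ^ nonzero_length theta) * Y ^ sum_list theta) *
        (scalar ((1 - t) ^ nonzero_length ?rho) * 1 ^ sum_list ?rho)) i j =
        (if int (sum_list tau) = int i \<and> int (sum_list theta) = int j then ?c else 0)"
      unfolding product coeff_XY_scalar coeff_XY_monomial by auto
  qed
  also have "\<dots> = b_coeff mu (int i) (int j) q"
    using assms by (simp add: b_coeff_def)
  finally show ?thesis .
qed

text \<open>Apply \<open>hook_value_coeff_sum\<close> to the specialized formula. The power \<open>q\<^bsup>n-m+i\<^esup>\<close> arises from \<open>q\<^sup>n\<close> and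
\<open>q\<^bsup>-(m-i)\<^esup>\<close>.\<close>

theorem hook_character:
  assumes chi: "q_rook_characters chi" and mu: "mu \<in> partitions n"
    and k: "1 \<le> k" "k \<le> m" and m: "m \<le> n"
  shows "chi (hook k (m - k)) mu =
    q_indet ^ (n - m) / (q_indet - 1) ^ length mu *
      (\<Sum>i=k..m. (-1) ^ (m - k) * a_coeff mu (int i) (int n - int m) q_indet * q_indet ^ i)"
proof -
  let ?q = "q_indet" and ?t = "inverse q_indet"
  let ?c = "?q ^ n / (?q - 1) ^ length mu"
  let ?a = "\<lambda>i. a_coeff mu (int i) (int n - int m) ?q"
  have hook: "hook k (m - k) \<in> partitions m" using hook_partition[of k "m - k"] k by simp
  have "(\<Sum>i=k..m. ?c * (?t ^ (m - i) * ?a i)) =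
      (\<Sum>i=k..m. coeff_XY (\<Sum>p=0..n. \<Sum>lam\<in>partitions p.
        scalar (chi lam mu) * hook_value lam) i (m - i))"
    unfolding frobenius_super_value[OF chi mu, symmetric] coeff_XY_scalar
    by (intro sum.cong refl, subst coeff_XY_super_product)
       (use partitionsD(3)[OF mu] m in auto)
  also have "\<dots> = (\<Sum>p=0..n. \<Sum>lam\<in>partitions p.
      chi lam mu * (\<Sum>i=k..m. coeff_XY (hook_value lam) i (m - i)))"
    unfolding coeff_XY_sum coeff_XY_scalar sum_distrib_left
    by (subst sum.swap, intro sum.cong refl, subst sum.swap, rule refl)
  also have "\<dots> = (\<Sum>p=0..n. \<Sum>lam\<in>partitions p.
      chi lam mu * (if lam = hook k (m - k) then (- 1) ^ (m - k) else 0))"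
    by (intro sum.cong refl) (simp only: hook_value_coeff_sum[OF k])
  also have "\<dots> = chi (hook k (m - k)) mu * (- 1) ^ (m - k)"
    by (rule sum_pick_partition[OF hook m])
  finally have "chi (hook k (m - k)) mu * (- 1) ^ (m - k) * (- 1) ^ (m - k) =
      (- 1) ^ (m - k) * (\<Sum>i=k..m. ?c * (?t ^ (m - i) * ?a i))"
    by (simp only: mult.commute)
  then have "chi (hook k (m - k)) mu =
      (- 1) ^ (m - k) * (\<Sum>i=k..m. ?c * (?t ^ (m - i) * ?a i))"
    by (simp add: mult.assoc power_add[symmetric] mult_2[symmetric] power_mult)
  also have "\<dots> = (\<Sum>i=k..m. ?q ^ (n - m) / (?q - 1) ^ length mu *
      ((- 1) ^ (m - k) * ?a i * ?q ^ i))"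
    unfolding sum_distrib_left
  proof (intro sum.cong refl)
    fix i assume i: "i \<in> {k..m}"
    have "n = (n - m) + i + (m - i)" using i m by simp
    then have "?q ^ n = ?q ^ (n - m) * ?q ^ i * ?q ^ (m - i)"
      by (metis power_add)
    then have "?q ^ n * ?t ^ (m - i) = ?q ^ (n - m) * ?q ^ i"
      by (simp add: power_inverse)
    then show "(- 1) ^ (m - k) * (?c * (?t ^ (m - i) * ?a i)) =
        ?q ^ (n - m) / (?q - 1) ^ length mu * ((- 1) ^ (m - k) * ?a i * ?q ^ i)"
      by (simp add: divide_inverse)
  qed
  finally show ?thesis by (simp only: sum_distrib_left)
qed

section \<open>Two-row characters\<close>

lemma schur_value_two_rows:
  assumes "sorted_wrt (\<ge>) (c # d # l)"
  shows "coeff_XY (schur_sum super_var 2 (c # d # l)) i j =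
    (if sum_list l = 0 \<and> d \<le> i \<and> i \<le> c \<and> c + d = i + j then 1 else 0)"
proof -
  have "schur_sum super_var 2 (c # d # l) =
      (if sum_list l = 0 then \<Sum>a=d..c. X ^ a * (Y ^ (c - a) * Y ^ d) else 0)"
    unfolding numeral_2_eq_2 schur_sum_two_variables[OF assms]
    by (auto simp: super_var_def sum_distrib_left mult_ac)
  moreover have "coeff_XY (\<Sum>a=d..c. X ^ a * (Y ^ (c - a) * Y ^ d)) i j =
      (\<Sum>a=d..c. if a = i then (if c - a + d = j then 1 else 0) else 0)"
    unfolding power_add[symmetric] coeff_XY_sum coeff_XY_monomial by (rule sum.cong) auto
  moreover have "\<dots> = (if d \<le> i \<and> i \<le> c \<and> c + d = i + j then 1 else 0)"
    by (subst sum.delta) auto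
  ultimately show ?thesis by (cases "sum_list l = 0") (simp_all only: coeff_XY_0 if_True if_False simp_thms)
qed

text \<open>A trailing empty row does not change the diagram, so the two-row case applies.\<close>

lemma schur_value_one_row:
  "coeff_XY (schur_sum super_var 2 [c]) i j = (if c = i + j then 1 else 0)"
proof -
  have "schur_sum super_var 2 [c] = schur_sum super_var 2 [c, 0]"
  proof -
    have "diagram [c] = diagram [c, 0]"
      by (auto simp: diagram_def less_Suc_eq nth_Cons')
    then show ?thesis by (simp only: schur_sum_def semistandard_tableaux_def)
  qed
  then show ?thesis by (auto simp: schur_value_two_rows)
qed

lemma two_row_partition: "1 \<le> k \<Longrightarrow> r \<le> k \<Longrightarrow> two_row k r \<in> partitions (k + r)"
  by (auto simp: two_row_def partitions_def)

text \<open>For shapes of size \<open>k + r\<close> with at most two rows, the first coefficient is 1 iff the first row has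
length at least \<open>k\<close>, and the second iff it has length at least \<open>k + 1\<close>. If \<open>r = 0\<close> the second
monomial does not exist.\<close>

lemma schur_value_coeff_diff:
  assumes "1 \<le> k" "r \<le> k" "lam \<in> partitions p"
  shows "coeff_XY (schur_sum super_var 2 lam) k r -
      (if r = 0 then 0 else coeff_XY (schur_sum super_var 2 lam) (k + 1) (r - 1)) =
    (if lam = two_row k r then 1 else 0)"
proof (cases lam)
  case Nil
  have "coeff_XY 1 i j = (if i = 0 \<and> j = 0 then 1 else 0)" for i j
    using coeff_XY_monomial[of 0 0 i j] by auto
  then show ?thesis using assms(1) by (simp add: Nil two_row_def)
next
  case lam: (Cons c l)
  note part = partitionsD[OF assms(3)]
  show ?thesis
  proof (cases l)
    case Nil
    then show ?thesis using assms by (auto simp: lam schur_value_one_row two_row_def)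
  next
    case (Cons d l')
    have "d \<le> c" "d \<noteq> 0" using part by (auto simp: lam Cons)
    moreover have "sum_list l' = 0 \<longleftrightarrow> l' = []"
      using part(2) by (cases l') (auto simp: lam Cons)
    ultimately show ?thesis
      using assms(1,2)
      unfolding lam Cons schur_value_two_rows[OF part(1)[unfolded lam Cons]] two_row_def by auto
  qed
qed

theorem two_row_character:
  assumes chi: "q_rook_characters chi" and mu: "mu \<in> partitions n"
    and k: "1 \<le> k" "k \<le> m" and m: "m \<le> n" and le: "m - k \<le> k"
  shows "chi (two_row k (m - k)) mu = q_indet ^ n / (q_indet - 1) ^ length mu *
    (b_coeff mu (int k) (int m - int k) q_indet
     - b_coeff mu (int k + 1) (int m - int k - 1) q_indet)"
proof -
  let ?q = "q_indet" and ?t = "inverse q_indet"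
  let ?c = "?q ^ n / (?q - 1) ^ length mu"
  define r where "r = m - k"
  define S where "S = (\<Sum>p=0..n. \<Sum>lam\<in>partitions p.
    scalar (chi lam mu) * schur_sum super_var 2 lam)"
  have row: "two_row k r \<in> partitions m" using two_row_partition[of k r] k le by (simp add: r_def)
  have "(\<Prod>i<2. linear_ratio ?t (super_var i)) = linear_ratio ?t X * linear_ratio ?t Y"
    by (simp add: numeral_2_eq_2 super_var_def)
  then have "linear_ratio ?t 1 * (\<Prod>i<2. linear_ratio ?t (super_var i)) =
      linear_ratio ?t X * (linear_ratio ?t Y * linear_ratio ?t 1)"
    by (simp only: mult_ac)
  then have S: "S = scalar ?c * prod_list (map (\<lambda>k. (linear_ratio ?t X *
      (linear_ratio ?t Y * linear_ratio ?t 1)) $ k) mu)"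
    unfolding S_def frobenius_value[OF chi mu, symmetric] by (simp only:)
  have coeff: "coeff_XY S i j = ?c * b_coeff mu (int i) (int j) ?q" if "i + j \<le> n" for i j
    unfolding S coeff_XY_scalar
    by (subst coeff_XY_two_variable_product) (use partitionsD(3)[OF mu] that in auto)
  have "chi (two_row k r) mu * 1 = (\<Sum>p=0..n. \<Sum>lam\<in>partitions p.
      chi lam mu * (if lam = two_row k r then 1 else 0))"
    by (rule sum_pick_partition[OF row m, symmetric])
  also have "\<dots> = (\<Sum>p=0..n. \<Sum>lam\<in>partitions p. chi lam mu *
      (coeff_XY (schur_sum super_var 2 lam) k r -
       (if r = 0 then 0 else coeff_XY (schur_sum super_var 2 lam) (k + 1) (r - 1))))"
    by (intro sum.cong refl)
       (use k le in \<open>simp only: schur_value_coeff_diff r_def\<close>)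
  also have "\<dots> = coeff_XY S k r - (if r = 0 then 0 else coeff_XY S (k + 1) (r - 1))"
    by (simp add: S_def coeff_XY_sum coeff_XY_scalar right_diff_distrib sum_subtractf)
  also have "\<dots> = ?c * (b_coeff mu (int k) (int r) ?q - b_coeff mu (int k + 1) (int r - 1) ?q)"
  proof (cases r)
    case 0
    then show ?thesis using k m by (simp add: coeff b_coeff_def)
  next
    case (Suc s)
    then show ?thesis
      using k m coeff[of k r] coeff[of "k + 1" s] by (simp add: r_def right_diff_distrib add.commute)
  qed
  finally show ?thesis using k by (simp add: r_def of_nat_diff)
qed

theorem theorem3p10:
  fixes chi :: "nat list \<Rightarrow> nat list \<Rightarrow> ratfun"
    and mu :: "nat list" and n m k :: nat
  assumes "q_rook_characters chi"
    and "mu \<in> partitions n"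
    and "1 \<le> k" and "k \<le> m" and "m \<le> n"
  shows "chi (hook k (m - k)) mu =
           q_indet ^ (n - m) / (q_indet - 1) ^ length mu *
             (\<Sum>i=k..m. (-1) ^ (m - k) * a_coeff mu (int i) (int n - int m) q_indet * q_indet ^ i)
       \<and> (m - k \<le> k \<longrightarrow>
           chi (two_row k (m - k)) mu =
             q_indet ^ n / (q_indet - 1) ^ length mu *
               (b_coeff mu (int k) (int m - int k) q_indet
                - b_coeff mu (int k + 1) (int m - int k - 1) q_indet))"
  using hook_character[OF assms] two_row_character[OF assms] by blast

end
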